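(* The set $\mathbf{Q}=\{A : \mathbf{NP}^A\not\subseteq\mathbf{BQP}^A\}\subseteq 2^\omega$ is $\boldsymbol{\Pi}^0_2$-hard, i.e., $\mathbf{Q}\notin\boldsymbol{\Sigma}^0_2$.
   Context: Binary strings are identified with natural numbers via a fixed effective enumeration of $\{0,1\}^{<\omega}$, so that an oracle is identified with an element of the Cantor space $2^\omega$ (product topology). $\mathbf{BQP}^A$ is the class of languages accepted with probability at least $2/3$ by polynomial-time oracle quantum Turing machines (Bernstein–Vazirani model) with oracle $A$. $\boldsymbol{\Sigma}^0_2$ is the class of countable unions of closed subsets of $2^\omega$; $\boldsymbol{\Pi}^0_2$ the class of countable intersections of open sets. *)

theory Defs
  imports "HOL-Analysis.Analysis" "HOL-Computational_Algebra.Polynomial"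
begin

section \<open>Strings and oracles\<close>

text \<open>Bijective base-2 numeration, most significant digit first: this enumerates the binary strings
  by length, and lexicographically within each length.\<close>

definition str_num :: "bool list \<Rightarrow> nat" where
  "str_num w = horner_sum (\<lambda>b. if b then 2 else 1) 2 (rev w)"

lemma bij_str_num: "bij str_num"
proof -
  define g :: "bool list \<Rightarrow> nat" where "g = horner_sum (\<lambda>b. if b then 2 else 1) 2"
  have g_Nil [simp]: "g [] = 0"
    and g_Cons [simp]: "\<And>b w. g (b # w) = (if b then 2 else 1) + 2 * g w"
    by (simp_all add: g_def)
  have "g v = g w \<Longrightarrow> v = w" for v w
  proof (induction v arbitrary: w)
    case Nil
    then show ?case by (cases w) (auto split: if_splits)
  next
    case (Cons b v)
    then obtain c u where w: "w = c # u"
      by (cases w) (auto split: if_splits)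
    with Cons.prems have "(if b then 2 else 1) + 2 * g v = (if c then 2 else 1) + 2 * g u"
      by simp
    then have "b = c \<and> g v = g u"
      by (cases b; cases c; simp; presburger)
    with Cons.IH w show ?case by simp
  qed
  then have "inj g" by (auto simp: inj_def)
  moreover have "\<exists>w. n = g w" for n
  proof (induction n rule: less_induct)
    case (less n)
    show ?case
    proof (cases "n = 0")
      case True
      then have "n = g []" by simp
      then show ?thesis by blast
    next
      case False
      then have "(n - 1) div 2 < n" by auto
      then obtain w where w: "(n - 1) div 2 = g w" using less by blast
      have "n = g (even n # w)" using False w by (cases "even n") (auto, presburger+)
      then show ?thesis by blast
    qed
  qed
  then have "surj g" by (auto simp: surj_def)
  ultimately have "bij g" by (simp add: bij_def)
  moreover have "bij (rev :: bool list \<Rightarrow> bool list)"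
    by (rule involuntory_imp_bij) simp
  moreover have "str_num = g \<circ> rev"
    by (auto simp: str_num_def g_def)
  ultimately show ?thesis by (metis bij_comp)
qed

text \<open>The space of oracles \<open>nat \<Rightarrow> bool\<close> carries the library's product topology, \<open>bool\<close> being
  discrete.\<close>

type_synonym cantor = "nat \<Rightarrow> bool"

abbreviation oracle_mem :: "cantor \<Rightarrow> bool list \<Rightarrow> bool" where
  "oracle_mem A w \<equiv> A (str_num w)"


section \<open>Tapes and configurations\<close>

text \<open>All machines have one two-way infinite tape, divided into an input track, a query track, an
  output track (each over the alphabet \<open>{#, 0, 1}\<close>, with \<open>None\<close> for the blank \<open>#\<close>) and one work
  track, whose alphabet is an arbitrary finite initial segment of \<open>nat\<close> with blank \<open>0\<close>. Any finite
  number of further tracks can be merged into the work track.\<close>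

datatype sym = Sym (inp: "bool option") (qry: "bool option") (outp: "bool option") (work: nat)

definition blank :: sym where
  "blank = Sym None None None 0"

fun set_qry :: "bool \<Rightarrow> sym \<Rightarrow> sym" where
  "set_qry b (Sym i q out k) = Sym i (Some b) out k"

datatype dir = MoveL | MoveR

fun shift :: "dir \<Rightarrow> int" where
  "shift MoveL = -1"
| "shift MoveR = 1"

datatype config = Config (tape_of: "int \<Rightarrow> sym") (head_of: int) (state_of: nat)

text \<open>The distinguished states are named by fixed numbers. State 3 is the postquery state of a
  quantum machine, and the positive answer state of a classical one.\<close>

abbreviation (input) q_init :: nat where "q_init \<equiv> 0"
abbreviation (input) q_final :: nat where "q_final \<equiv> 1"
abbreviation (input) q_query :: nat where "q_query \<equiv> 2"
abbreviation (input) q_post :: nat where "q_post \<equiv> 3"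
abbreviation (input) q_yes :: nat where "q_yes \<equiv> 3"
abbreviation (input) q_no :: nat where "q_no \<equiv> 4"

definition init_tape :: "bool list \<Rightarrow> int \<Rightarrow> sym" where
  "init_tape x i =
     (if 0 \<le> i \<and> i < int (length x) then Sym (Some (x ! nat i)) None None 0 else blank)"

definition init_config :: "bool list \<Rightarrow> config" where
  "init_config x = Config (init_tape x) 0 q_init"

definition query_cells :: "(int \<Rightarrow> sym) \<Rightarrow> int set" where
  "query_cells T = {i. qry (T i) \<noteq> None}"

text \<open>The query string is the content of the single block of nonblank cells on the query track. To
  make the query operation total, a query track whose nonblank cells do not form one contiguous
  block is treated like an empty one.\<close>

definition query_string :: "(int \<Rightarrow> sym) \<Rightarrow> bool list" where
  "query_string T =
     (if \<exists>a b. a \<le> b \<and> query_cells T = {a..b}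
      then map (\<lambda>i. the (qry (T i))) [Min (query_cells T)..Max (query_cells T)]
      else [])"


section \<open>Classical machines and NP\<close>

text \<open>A (nondeterministic) machine is a finite set of rules \<open>(q, s, s', q', d)\<close>: in state \<open>q\<close>,
  scanning \<open>s\<close>, it may write \<open>s'\<close>, enter \<open>q'\<close> and move in direction \<open>d\<close>. The set of states and the
  tape alphabet are those occurring in the rules. No rule is applied in the final state.\<close>

type_synonym rules = "(nat \<times> sym \<times> sym \<times> nat \<times> dir) set"

inductive tm_step :: "rules \<Rightarrow> config \<Rightarrow> config \<Rightarrow> bool" for R where
  "(q, T h, s', q', d) \<in> R \<Longrightarrow> q \<noteq> q_final \<Longrightarrow>
     tm_step R (Config T h q) (Config (T(h := s')) (h + shift d) q')"

definition deterministic :: "rules \<Rightarrow> bool" where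
  "deterministic R \<longleftrightarrow>
     (\<forall>q s s' q' d s'' q'' d'. (q, s, s', q', d) \<in> R \<longrightarrow> (q, s, s'', q'', d') \<in> R \<longrightarrow>
        s' = s'' \<and> q' = q'' \<and> d = d')"

text \<open>In the oracle model, rules for the query state are ignored: the only step from there is to one
  of the two answer states.\<close>

inductive otm_step :: "rules \<Rightarrow> cantor \<Rightarrow> config \<Rightarrow> config \<Rightarrow> bool" for R A where
  "state_of c \<noteq> q_query \<Longrightarrow> tm_step R c c' \<Longrightarrow> otm_step R A c c'"
| "otm_step R A (Config T h q_query)
     (Config T h (if oracle_mem A (query_string T) then q_yes else q_no))"

text \<open>On every input of length \<open>n\<close>, every computation path stops within \<open>p n\<close> steps; a path accepts
  if it reaches the final state, and it rejects if it gets stuck elsewhere.\<close>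

definition NP :: "cantor \<Rightarrow> bool list set set" where
  "NP A = {L. \<exists>R (p :: nat poly). finite R \<and>
     (\<forall>x. (\<nexists>c. (otm_step R A ^^ Suc (poly p (length x))) (init_config x) c) \<and>
          (x \<in> L \<longleftrightarrow> (\<exists>c. (otm_step R A)\<^sup>*\<^sup>* (init_config x) c \<and> state_of c = q_final)))}"


section \<open>Polynomial-time computable amplitudes\<close>

text \<open>A sign bit followed by the binary digits of an integer, least significant digit first.\<close>

fun decode_int :: "bool list \<Rightarrow> int" where
  "decode_int [] = 0"
| "decode_int (neg # bs) = (if neg then -1 else 1) * horner_sum of_bool 2 bs"

definition output_is :: "(int \<Rightarrow> sym) \<Rightarrow> bool list \<Rightarrow> bool" where
  "output_is T w \<longleftrightarrow>
     (\<forall>i. outp (T i) = (if 0 \<le> i \<and> i < int (length w) then Some (w ! nat i) else None))"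

text \<open>A deterministic machine without oracle computes, from \<open>n\<close> in unary and in time polynomial
  in \<open>n\<close>, a dyadic rational with denominator \<open>2 ^ n\<close> within \<open>2 ^ -n\<close> of \<open>r\<close>.\<close>

definition polytime_real :: "real \<Rightarrow> bool" where
  "polytime_real r \<longleftrightarrow> (\<exists>R (p :: nat poly). finite R \<and> deterministic R \<and>
     (\<forall>n. \<exists>t \<le> poly p n. \<exists>c w.
        (tm_step R ^^ t) (init_config (replicate n True)) c \<and> state_of c = q_final \<and>
        output_is (tape_of c) w \<and> \<bar>of_int (decode_int w) / 2 ^ n - r\<bar> \<le> 1 / 2 ^ n))"

definition polytime_complex :: "complex \<Rightarrow> bool" where
  "polytime_complex \<alpha> \<longleftrightarrow> polytime_real (Re \<alpha>) \<and> polytime_real (Im \<alpha>)"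


section \<open>Oracle quantum Turing machines and BQP\<close>

text \<open>\<open>delta M q s s' q' d\<close> is the amplitude with which \<open>M\<close>, in state \<open>q\<close> scanning \<open>s\<close>, writes
  \<open>s'\<close>, enters state \<open>q'\<close> and moves in direction \<open>d\<close>.\<close>

record qtm =
  n_states :: nat
  n_work :: nat
  delta :: "nat \<Rightarrow> sym \<Rightarrow> sym \<Rightarrow> nat \<Rightarrow> dir \<Rightarrow> complex"

definition alphabet :: "qtm \<Rightarrow> sym set" where
  "alphabet M = {s. work s < n_work M}"

definition is_qtm :: "qtm \<Rightarrow> bool" where
  "is_qtm M \<longleftrightarrow> n_states M \<ge> 4 \<and> n_work M \<ge> 1 \<and>
     (\<forall>q s s' q' d. polytime_complex (delta M q s s' q' d)) \<and>
     (\<forall>q s s' q' d. delta M q s s' q' d \<noteq> 0 \<longrightarrow>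
        q < n_states M \<and> s \<in> alphabet M \<and> s' \<in> alphabet M \<and> q' < n_states M)"

definition configs :: "qtm \<Rightarrow> config set" where
  "configs M = {c. state_of c < n_states M \<and> range (tape_of c) \<subseteq> alphabet M \<and>
                   finite {i. tape_of c i \<noteq> blank}}"

text \<open>A nonempty query string is \<open>x @ [b]\<close> with target bit \<open>b\<close>, which is replaced by the exclusive
  or (on \<open>bool\<close>: \<open>\<noteq>\<close>) of \<open>b\<close> and the oracle's answer on \<open>x\<close>. An empty query is a no-op.\<close>

definition query_tape :: "cantor \<Rightarrow> (int \<Rightarrow> sym) \<Rightarrow> (int \<Rightarrow> sym)" where
  "query_tape A T =
     (let w = query_string T; e = Max (query_cells T)
      in if w = [] then T
         else T(e := set_qry (last w \<noteq> oracle_mem A (butlast w)) (T e)))"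

definition step_amp :: "qtm \<Rightarrow> cantor \<Rightarrow> config \<Rightarrow> config \<Rightarrow> complex" where
  "step_amp M A c c' =
     (if state_of c = q_query then
        (if c' = Config (query_tape A (tape_of c)) (head_of c) q_post then 1 else 0)
      else if \<exists>s. tape_of c' = (tape_of c)(head_of c := s) then
        (\<Sum>d \<in> {MoveL, MoveR}.
           if head_of c' = head_of c + shift d
           then delta M (state_of c) (tape_of c (head_of c)) (tape_of c' (head_of c)) (state_of c') d
           else 0)
      else 0)"

type_synonym superpos = "config \<Rightarrow> complex"

definition supp :: "superpos \<Rightarrow> config set" where
  "supp \<psi> = {c. \<psi> c \<noteq> 0}"

definition superpositions :: "qtm \<Rightarrow> superpos set" where
  "superpositions M = {\<psi>. finite (supp \<psi>) \<and> supp \<psi> \<subseteq> configs M}"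

definition sq_norm :: "superpos \<Rightarrow> real" where
  "sq_norm \<psi> = (\<Sum>c \<in> supp \<psi>. (cmod (\<psi> c))\<^sup>2)"

definition evolve :: "qtm \<Rightarrow> cantor \<Rightarrow> superpos \<Rightarrow> superpos" where
  "evolve M A \<psi> = (\<lambda>c'. \<Sum>c \<in> supp \<psi>. \<psi> c * step_amp M A c c')"

definition well_formed :: "qtm \<Rightarrow> bool" where
  "well_formed M \<longleftrightarrow> (\<forall>A. \<forall>\<psi> \<in> superpositions M. sq_norm (evolve M A \<psi>) = sq_norm \<psi>)"

definition normal_form :: "qtm \<Rightarrow> bool" where
  "normal_form M \<longleftrightarrow> (\<forall>s \<in> alphabet M. \<forall>s' q' d.
     delta M q_final s s' q' d = (if s' = s \<and> q' = q_init \<and> d = MoveR then 1 else 0))"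

definition run :: "qtm \<Rightarrow> cantor \<Rightarrow> bool list \<Rightarrow> nat \<Rightarrow> superpos" where
  "run M A x t = (evolve M A ^^ t) (\<lambda>c. if c = init_config x then 1 else 0)"

definition halts_at :: "qtm \<Rightarrow> cantor \<Rightarrow> bool list \<Rightarrow> nat \<Rightarrow> bool" where
  "halts_at M A x T \<longleftrightarrow>
     (\<forall>c \<in> supp (run M A x T). state_of c = q_final) \<and>
     (\<forall>t < T. \<forall>c \<in> supp (run M A x t). state_of c \<noteq> q_final)"

text \<open>The probability of seeing \<open>1\<close> in the start cell of the output track.\<close>

definition accept_prob :: "superpos \<Rightarrow> real" where
  "accept_prob \<psi> = (\<Sum>c \<in> {c \<in> supp \<psi>. outp (tape_of c 0) = Some True}. (cmod (\<psi> c))\<^sup>2)"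

text \<open>The condition on \<open>head_of\<close> says that the machine is stationary.\<close>

definition BQP :: "cantor \<Rightarrow> bool list set set" where
  "BQP A = {L. \<exists>M (p :: nat poly). is_qtm M \<and> well_formed M \<and> normal_form M \<and>
     (\<forall>x. \<exists>T \<le> poly p (length x). halts_at M A x T \<and>
        (\<forall>c \<in> supp (run M A x T). head_of c = 0) \<and>
        (x \<in> L \<longrightarrow> accept_prob (run M A x T) \<ge> 2 / 3) \<and>
        (x \<notin> L \<longrightarrow> 1 - accept_prob (run M A x T) \<ge> 2 / 3))}"

end

theory Submission
  imports Defs "HOL-Real_Asymp.Real_Asymp"
begin

text \<open>Baire category. For a fixed quantum machine and time bound, the oracles \<open>A\<close> relative to which it
  fails to decide \<open>{x. \<exists>w. \<bar>w\<bar> = \<bar>x\<bar> \<and> w \<in> A}\<close> form an open set, dense by the hybrid argument of Bennett,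
  Bernstein, Brassard and Vazirani; as there are countably many machines, \<open>NP\<^sup>A \<subseteq> BQP\<^sup>A\<close> fails on a
  comeager set. On the other hand every finite condition extends to an oracle with \<open>NP\<^sup>A \<subseteq> BQP\<^sup>A\<close>, whose
  values on long strings encode the behaviour of nondeterministic machines on the shorter part of the
  oracle. So the complement is dense, and a comeager set with dense complement is not
  \<open>F\<^sub>\<sigma>\<close>.\<close>

section \<open>Topology of the Cantor space\<close>

text \<open>The harder half is the density of the oracles with
  \<open>NP A \<subseteq> BQP A\<close>: a quantum machine must be exhibited that is well formed, in
  normal form, stationary, and halts at one definite time. A reversible classical machine with
  amplitudes 0 and 1 is built, and it computes almost nothing. In particular it never evaluates the
  polynomial time bound; the oracle also holds stop signals. The machine extends its query bit by
  bit, and the answer to each query becomes the next bit of the query. The answer False lengthens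
  the padding; the answer True ends it and turns the string into the question whether the
  nondeterministic machine accepts. The definition of such an oracle is not circular because the
  question contains the step bound \<open>k\<close> in unary: in \<open>k\<close> steps at most
  \<open>k\<close> query cells can be filled, so the simulated run consults only shorter strings. A
  finite condition is respected because every machine has arbitrarily large codes \<open>e\<close>,
  and \<open>e\<close> too is written in unary, which pushes all relevant strings beyond the
  prescribed part.\<close>

definition cylinder :: "nat \<Rightarrow> cantor \<Rightarrow> cantor set" where
  "cylinder N A = {B. \<forall>i<N. B i = A i}"

lemma open_cylinder: "open (cylinder N A)"
proof -
  have "open (Pi\<^sub>E UNIV (\<lambda>i. if i < N then {A i} else UNIV))"
    by (rule open_PiE) (auto simp: open_discrete)
  also have "Pi\<^sub>E UNIV (\<lambda>i. if i < N then {A i} else UNIV) = cylinder N A"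
    by (auto simp: cylinder_def PiE_def Pi_def extensional_def split: if_splits)
  finally show ?thesis .
qed

lemma open_contains_cylinder:
  fixes U :: "cantor set"
  assumes "open U" "A \<in> U"
  shows "\<exists>N. cylinder N A \<subseteq> U"
proof -
  from assms have "openin (product_topology (\<lambda>i. euclidean) UNIV) U"
    by (simp add: open_fun_def)
  then obtain V where V: "finite {i. V i \<noteq> (UNIV :: bool set)}" "A \<in> Pi\<^sub>E UNIV V" "Pi\<^sub>E UNIV V \<subseteq> U"
    using assms(2) by (auto simp: openin_product_topology_alt)
  from V(1) obtain N where N: "\<forall>i \<in> {i. V i \<noteq> UNIV}. i < N"
    using finite_nat_set_iff_bounded by blast
  have "cylinder N A \<subseteq> Pi\<^sub>E UNIV V"
  proof
    fix B assume "B \<in> cylinder N A"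
    then have "B i \<in> V i" for i
      using N V(2) by (cases "i < N") (auto simp: cylinder_def PiE_def Pi_def)
    then show "B \<in> Pi\<^sub>E UNIV V" by auto
  qed
  with V(3) show ?thesis by blast
qed

lemma openI_cylinder:
  assumes "\<And>A. A \<in> U \<Longrightarrow> \<exists>N. cylinder N A \<subseteq> U"
  shows "open U"
proof (subst open_subopen, intro ballI)
  fix A assume "A \<in> U"
  then obtain N where "cylinder N A \<subseteq> U" using assms by blast
  moreover have "A \<in> cylinder N A" by (simp add: cylinder_def)
  ultimately show "\<exists>T. open T \<and> A \<in> T \<and> T \<subseteq> U" using open_cylinder by blast
qed

definition cyl_dense :: "cantor set \<Rightarrow> bool" where
  "cyl_dense U \<longleftrightarrow> (\<forall>N A. \<exists>B \<in> U. B \<in> cylinder N A)"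

lemma closure_cyl_dense:
  assumes "cyl_dense U"
  shows "closure U = UNIV"
proof -
  have "A \<in> closure U" for A
  proof (subst closure_iff_nhds_not_empty, intro allI impI)
    fix V S assume "S \<subseteq> V" "open S" "A \<in> S"
    then obtain N where "cylinder N A \<subseteq> S" using open_contains_cylinder by blast
    moreover obtain B where "B \<in> U" "B \<in> cylinder N A" using assms unfolding cyl_dense_def by blast
    ultimately show "U \<inter> V \<noteq> {}" using \<open>S \<subseteq> V\<close> by blast
  qed
  then show ?thesis by blast
qed

text \<open>By Tychonoff the product is compact, and it is Hausdorff, hence locally compact and
  regular; this is the version of the Baire category theorem that is applied.\<close>

lemma cantor_Baire:
  fixes \<U> :: "cantor set set"
  assumes "countable \<U>" "\<And>U. U \<in> \<U> \<Longrightarrow> open U \<and> cyl_dense U"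
  shows "\<Inter>\<U> \<noteq> {}"
proof -
  let ?X = "product_topology (\<lambda>i::nat. euclidean :: bool topology) UNIV"
  have X: "?X = euclidean" by (simp add: euclidean_product_topology)
  have "compact_space (euclidean :: bool topology)"
    by (simp add: compact_space_def finite_imp_compact)
  then have "compact_space ?X" by (simp add: compact_space_product_topology)
  moreover have "Hausdorff_space ?X"
  proof -
    have "Hausdorff_space (euclidean :: bool topology)"
      unfolding Hausdorff_space_def
    proof (intro allI impI)
      fix x y :: bool assume "x \<in> topspace euclidean \<and> y \<in> topspace euclidean \<and> x \<noteq> y"
      then show "\<exists>U V. openin euclidean U \<and> openin euclidean V \<and> x \<in> U \<and> y \<in> V \<and> disjnt U V"
        by (intro exI[of _ "{x}"] exI[of _ "{y}"]) (auto simp: open_discrete)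
    qed
    then show ?thesis by (simp add: Hausdorff_space_product_topology)
  qed
  ultimately have "locally_compact_space ?X \<and> regular_space ?X"
    by (simp add: compact_imp_locally_compact_space compact_Hausdorff_imp_regular_space)
  then have "?X closure_of \<Inter>\<U> = topspace ?X"
    using assms by (intro Baire_category) (auto simp: X closure_cyl_dense)
  then show ?thesis by (auto simp: X)
qed

section \<open>Countably many machines\<close>

instance sym :: countable by countable_datatype
instance dir :: countable by countable_datatype
instance poly :: ("{zero,countable}") countable
proof
  obtain f :: "'a list \<Rightarrow> nat" where "inj f" by (meson ex_inj)
  then have "inj (f \<circ> coeffs)" by (intro inj_compose) (auto simp: inj_def coeffs_eq_iff)
  then show "\<exists>f :: 'a poly \<Rightarrow> nat. inj f" by blast
qed

section \<open>Countability of the computable amplitudes and of the quantum machines\<close>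

lemma tm_step_final: "tm_step R c c' \<Longrightarrow> state_of c \<noteq> q_final"
  by (induction rule: tm_step.induct) auto

lemma tm_step_det:
  assumes "deterministic R" "tm_step R c c1" "tm_step R c c2"
  shows "c1 = c2"
  using assms(2,3,1) by (auto elim!: tm_step.cases simp: deterministic_def) blast+

text \<open>No step leaves the final state, so a deterministic machine cannot pass through one
  halting configuration on its way to another. Hence \<open>s\<close> and \<open>t\<close> need not
  be assumed equal.\<close>

lemma tm_halt_unique:
  assumes "deterministic R"
  shows "(tm_step R ^^ s) c c1 \<Longrightarrow> (tm_step R ^^ t) c c2 \<Longrightarrow>
    state_of c1 = q_final \<Longrightarrow> state_of c2 = q_final \<Longrightarrow> c1 = c2"
proof (induction s arbitrary: c t)
  case 0
  then show ?case
    by (cases t) (auto dest: tm_step_final dest!: relpowp_Suc_D2 simp del: relpowp.simps(2))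
next
  case (Suc s)
  from Suc.prems(1) obtain d where d: "tm_step R c d" "(tm_step R ^^ s) d c1"
    by (blast dest: relpowp_Suc_D2)
  with Suc.prems(2,4) obtain t' where t': "t = Suc t'"
    by (cases t) (auto dest: tm_step_final)
  with Suc.prems(2) obtain e where e: "tm_step R c e" "(tm_step R ^^ t') e c2"
    by (blast dest: relpowp_Suc_D2)
  have "d = e" by (rule tm_step_det[OF assms d(1) e(1)])
  with Suc.IH[OF d(2) _ Suc.prems(3,4)] e(2) show ?case by blast
qed

lemma output_is_unique:
  assumes "output_is T v" "output_is T w"
  shows "v = w"
proof -
  have *: "(0 \<le> i \<and> i < int (length v)) = (0 \<le> i \<and> i < int (length w))"
    and **: "0 \<le> i \<and> i < int (length v) \<Longrightarrow> v ! nat i = w ! nat i" for i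
    using assms[unfolded output_is_def, THEN spec, of i] by (auto split: if_splits)
  from *[of "int (length v)"] *[of "int (length w)"] have "length v = length w" by auto
  then show ?thesis
    using **[of "int j" for j] by (intro nth_equalityI) auto
qed

text \<open>The body of \<open>polytime_real\<close> with its witnesses turned into parameters, so
  that a real can be traced back to the finite rule set computing it.\<close>

definition computes_real :: "rules \<Rightarrow> nat poly \<Rightarrow> real \<Rightarrow> bool" where
  "computes_real R p r \<longleftrightarrow> finite R \<and> deterministic R \<and>
     (\<forall>n. \<exists>t \<le> poly p n. \<exists>c w.
        (tm_step R ^^ t) (init_config (replicate n True)) c \<and> state_of c = q_final \<and>
        output_is (tape_of c) w \<and> \<bar>of_int (decode_int w) / 2 ^ n - r\<bar> \<le> 1 / 2 ^ n)"

text \<open>Whatever the time bounds, both computations on input \<open>n\<close> halt in the same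
  configuration, so a single dyadic rational is within \<open>1 / 2 ^ n\<close> of both reals, for
  every \<open>n\<close>.\<close>

lemma computes_real_unique:
  assumes "computes_real R p r" "computes_real R p' r'"
  shows "r = r'"
proof -
  have det: "deterministic R" using assms by (simp add: computes_real_def)
  have "\<bar>r - r'\<bar> \<le> 2 * (1 / 2) ^ n" for n
  proof -
    obtain t c w where 1: "(tm_step R ^^ t) (init_config (replicate n True)) c" "state_of c = q_final"
      "output_is (tape_of c) w" "\<bar>of_int (decode_int w) / 2 ^ n - r\<bar> \<le> 1 / 2 ^ n"
      using assms(1) unfolding computes_real_def by meson
    obtain t' c' w' where 2: "(tm_step R ^^ t') (init_config (replicate n True)) c'" "state_of c' = q_final"
      "output_is (tape_of c') w'" "\<bar>of_int (decode_int w') / 2 ^ n - r'\<bar> \<le> 1 / 2 ^ n"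
      using assms(2) unfolding computes_real_def by meson
    have "c = c'" using tm_halt_unique[OF det 1(1) 2(1) 1(2) 2(2)] .
    with 1 2 output_is_unique have "w = w'" by blast
    with 1(4) 2(4) show ?thesis unfolding power_one_over by (simp add: abs_le_iff)
  qed
  moreover have "(\<lambda>n. 2 * (1 / 2) ^ n) \<longlonglongrightarrow> (2 * 0 :: real)"
    by (intro tendsto_intros LIMSEQ_power_zero) auto
  ultimately have "\<bar>r - r'\<bar> \<le> 2 * 0"
    by (intro LIMSEQ_le_const[where X = "\<lambda>n. 2 * (1 / 2) ^ n"]) auto
  then show ?thesis by simp
qed

lemma countable_finite_rules: "countable {R :: rules. finite R}"
  by (rule countable_Collect_finite)

lemma countable_polytime_real: "countable (Collect polytime_real)"
proof -
  let ?f = "\<lambda>R. THE r. \<exists>p. computes_real R p r"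
  have "Collect polytime_real \<subseteq> ?f ` {R. finite R}"
  proof
    fix r assume "r \<in> Collect polytime_real"
    then obtain R p where "computes_real R p r"
      unfolding polytime_real_def computes_real_def by blast
    then have "?f R = r" "finite R"
      using computes_real_unique by (blast intro!: the_equality, simp add: computes_real_def)
    then show "r \<in> ?f ` {R. finite R}" by blast
  qed
  then show ?thesis using countable_finite_rules countable_image countable_subset by blast
qed

lemma countable_polytime_complex: "countable (Collect polytime_complex)"
proof -
  have "Collect polytime_complex \<subseteq> case_prod Complex ` (Collect polytime_real \<times> Collect polytime_real)"
    by (force simp: polytime_complex_def image_iff complex_eq_iff)
  then show ?thesis
    using countable_polytime_real by (meson countable_SIGMA countable_image countable_subset)
qed

lemma finite_alphabet: "finite (alphabet M)"
proof -
  have "alphabet M \<subseteq> (\<lambda>(i, q, out, k). Sym i q out k) ` (UNIV \<times> UNIV \<times> UNIV \<times> {..<n_work M})"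
  proof
    fix s assume "s \<in> alphabet M"
    then show "s \<in> (\<lambda>(i, q, out, k). Sym i q out k) ` (UNIV \<times> UNIV \<times> UNIV \<times> {..<n_work M})"
      by (cases s) (auto simp: alphabet_def image_iff)
  qed
  then show ?thesis by (rule finite_subset) auto
qed

lemma finite_UNIV_dir: "finite (UNIV :: dir set)"
proof -
  have "(UNIV :: dir set) = {MoveL, MoveR}" by (auto intro: dir.exhaust)
  then show ?thesis by (metis finite.emptyI finite_insert)
qed

text \<open>\<open>delta\<close> lives on infinite types, but \<open>is_qtm\<close> makes it vanish
  outside a finite index set determined by the two sizes. A machine is thus a pair of sizes with a
  finite table of entries from a countable set.\<close>

lemma countable_qtms: "countable (Collect is_qtm)"
proof -
  define I where "I = (\<lambda>(m :: nat, k). {q. q < m} \<times> {s. work s < k} \<times> {s. work s < k} \<times> {q. q < m} \<times> (UNIV :: dir set))"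
  define S where "S = Sigma UNIV (\<lambda>mk. Pi\<^sub>E (I mk) (\<lambda>_. Collect polytime_complex))"
  define g where "g = (\<lambda>(mk, f). \<lparr>n_states = fst mk, n_work = snd mk,
    delta = (\<lambda>q s s' q' d. if (q, s, s', q', d) \<in> I mk then f (q, s, s', q', d) else 0)\<rparr>)"
  have "finite (I mk)" for mk
  proof -
    have "finite {s. work s < snd mk}"
      using finite_alphabet[of "\<lparr>n_states = 0, n_work = snd mk, delta = undefined\<rparr>"]
      by (simp add: alphabet_def)
    then show ?thesis by (auto simp: I_def split: prod.split intro!: finite_cartesian_product finite_UNIV_dir)
  qed
  then have "countable S"
    unfolding S_def by (intro countable_SIGMA countable_PiE countable_polytime_complex) auto
  moreover have "Collect is_qtm \<subseteq> g ` S"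
  proof
    fix M assume "M \<in> Collect is_qtm"
    then have M: "is_qtm M" by simp
    let ?mk = "(n_states M, n_work M)"
    let ?f = "restrict (\<lambda>(q, s, s', q', d). delta M q s s' q' d) (I ?mk)"
    have "(?mk, ?f) \<in> S" using M by (auto simp: S_def is_qtm_def)
    moreover have "delta M q s s' q' d = 0" if "(q, s, s', q', d) \<notin> I ?mk" for q s s' q' d
    proof (rule ccontr)
      assume "delta M q s s' q' d \<noteq> 0"
      with M have "q < n_states M \<and> s \<in> alphabet M \<and> s' \<in> alphabet M \<and> q' < n_states M"
        unfolding is_qtm_def by blast
      with that show False by (auto simp: I_def alphabet_def)
    qed
    then have "g (?mk, ?f) = M" by (auto simp: g_def fun_eq_iff intro!: qtm.equality)
    ultimately show "M \<in> g ` S" by force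
  qed
  ultimately show ?thesis using countable_image countable_subset by blast
qed

section \<open>Tapes holding an input and a query\<close>

definition opt_nth :: "'a list \<Rightarrow> int \<Rightarrow> 'a option" where
  "opt_nth w i = (if 0 \<le> i \<and> i < int (length w) then Some (w ! nat i) else None)"

lemma opt_nth_simps [simp]:
  "opt_nth [] i = None"
  "opt_nth w (int j) = (if j < length w then Some (w ! j) else None)"
  "i < 0 \<Longrightarrow> opt_nth w i = None"
  by (auto simp: opt_nth_def)

lemma opt_nth_snoc: "opt_nth (w @ [b]) = (opt_nth w)(int (length w) := Some b)"
  by (auto simp: opt_nth_def fun_eq_iff nth_append)

definition tape :: "(int \<Rightarrow> nat) \<Rightarrow> bool list \<Rightarrow> bool list \<Rightarrow> int \<Rightarrow> sym" where
  "tape m x w i = Sym (opt_nth x i) (opt_nth w i) None (m i)"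

lemma init_tape_eq: "init_tape x = tape (\<lambda>_. 0) x []"
  by (auto simp: init_tape_def tape_def opt_nth_def blank_def fun_eq_iff)

lemma tape_snoc:
  "(tape m x w)(int (length w) := Sym (opt_nth x (int (length w))) (Some b) None k) =
     tape (m(int (length w) := k)) x (w @ [b])"
  by (auto simp: tape_def opt_nth_snoc fun_eq_iff)

lemma query_cells_tape: "query_cells (tape m x w) = {0..int (length w) - 1}"
  by (auto simp: query_cells_def tape_def opt_nth_def)

lemma query_string_tape [simp]: "query_string (tape m x w) = w"
proof (cases "w = []")
  case True
  then show ?thesis by (auto simp: query_string_def query_cells_tape)
next
  case False
  then have "(0::int) \<le> int (length w) - 1" by (cases w) auto
  then have "Min {0..int (length w) - 1} = 0" "Max {0..int (length w) - 1} = int (length w) - 1"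
    "\<exists>a b. a \<le> b \<and> {0..int (length w) - 1} = {a..b}"
    by (auto intro: Min_eqI Max_eqI)
  then have "query_string (tape m x w) =
      map (\<lambda>i. the (qry (tape m x w i))) [0..int (length w) - 1]"
    by (simp add: query_string_def query_cells_tape)
  also have "\<dots> = w"
    by (intro nth_equalityI) (auto simp: tape_def opt_nth_def)
  finally show ?thesis .
qed

lemma query_tape_tape:
  "query_tape A (tape m x (w @ [b])) = tape m x (w @ [b \<noteq> oracle_mem A w])"
proof -
  have "Max (query_cells (tape m x (w @ [b]))) = int (length w)"
    by (auto simp: query_cells_tape intro: Max_eqI)
  then show ?thesis
    by (auto simp: query_tape_def Let_def tape_def opt_nth_snoc fun_eq_iff)
qed

section \<open>A language separating NP from BQP generically\<close>

definition sep_lang :: "cantor \<Rightarrow> bool list set" where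
  "sep_lang A = {x. \<exists>w. length w = length x \<and> oracle_mem A w}"

text \<open>One query bit is guessed per input cell, so the query has exactly the length of the
  input; the first blank cell triggers the query. The negative answer state has no rule, so that
  path gets stuck and rejects.\<close>

definition guess_rules :: rules where
  "guess_rules =
     (\<lambda>(b, g). (q_init, Sym (Some b) None None 0, Sym (Some b) (Some g) None 0, q_init, MoveR)) ` UNIV
     \<union> {(q_init, blank, blank, q_query, MoveR), (q_yes, blank, blank, q_final, MoveR)}"

lemma otm_step_cases: "otm_step R A c c' \<Longrightarrow> state_of c = q_query \<or> tm_step R c c'"
  by (induction rule: otm_step.induct) auto

lemma guess_init_step:
  assumes "otm_step guess_rules A (Config (tape (\<lambda>_. 0) x w) (int (length w)) q_init) c"
    "length w \<le> length x"
  shows "if length w < length x then \<exists>g. c = Config (tape (\<lambda>_. 0) x (w @ [g])) (int (length w) + 1) q_init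
    else c = Config (tape (\<lambda>_. 0) x w) (int (length w) + 1) q_query"
proof -
  have upd: "(tape (\<lambda>_. 0) x w)(int (length w) := Sym (Some b) (Some g) None 0) = tape (\<lambda>_. 0) x (w @ [g])"
    if "tape (\<lambda>_. 0) x w (int (length w)) = Sym (Some b) None None 0" for b g
    using that tape_snoc[of "\<lambda>_. 0" x w g 0] by (auto simp: tape_def fun_upd_idem split: if_splits)
  have blank: "tape (\<lambda>_. 0) x w (int (length w)) = blank \<longleftrightarrow> length w \<ge> length x"
    by (auto simp: tape_def blank_def)
  from assms(1) have "tm_step guess_rules (Config (tape (\<lambda>_. 0) x w) (int (length w)) q_init) c"
    by (cases rule: otm_step.cases) auto
  then show ?thesis
  proof (cases rule: tm_step.cases)
    case (1 s' q' d)
    show ?thesis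
    proof (cases "length w < length x")
      case True
      then have "tape (\<lambda>_. 0) x w (int (length w)) \<noteq> blank" using blank by simp
      with 1 True show ?thesis
        by (auto simp: guess_rules_def upd)
    next
      case False
      then have "tape (\<lambda>_. 0) x w (int (length w)) = blank" using blank by simp
      with 1 False show ?thesis
        by (auto simp: guess_rules_def blank_def)
    qed
  qed
qed

text \<open>One invariant yields both the time bound, since no configuration exists after
  \<open>length x + 3\<close> steps, and soundness, since the final state occurs only after a
  positive answer on the guessed string.\<close>

lemma guess_run:
  assumes "(otm_step guess_rules A ^^ t) (init_config x) c"
  shows "\<exists>w. length w = min t (length x) \<and>
     (if t \<le> length x then c = Config (tape (\<lambda>_. 0) x w) (int t) q_init
      else if t = length x + 1 then c = Config (tape (\<lambda>_. 0) x w) (int t) q_query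
      else if t = length x + 2 then
        c = Config (tape (\<lambda>_. 0) x w) (int (length x) + 1) (if oracle_mem A w then q_yes else q_no)
      else t = length x + 3 \<and> state_of c = q_final \<and> oracle_mem A w)"
  using assms
proof (induction t arbitrary: c)
  case 0
  then show ?case by (simp add: init_config_def init_tape_eq)
next
  case (Suc t)
  from Suc.prems obtain d where d: "(otm_step guess_rules A ^^ t) (init_config x) d"
    and step: "otm_step guess_rules A d c" by auto
  from Suc.IH[OF d] obtain w where w: "length w = min t (length x)" and
    cases: "if t \<le> length x then d = Config (tape (\<lambda>_. 0) x w) (int t) q_init
      else if t = length x + 1 then d = Config (tape (\<lambda>_. 0) x w) (int t) q_query
      else if t = length x + 2 then
        d = Config (tape (\<lambda>_. 0) x w) (int (length x) + 1) (if oracle_mem A w then q_yes else q_no)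
      else t = length x + 3 \<and> state_of d = q_final \<and> oracle_mem A w" by blast
  have "t \<le> length x + 3" using cases by (simp split: if_splits)
  then consider "t \<le> length x" | "t = length x + 1" | "t = length x + 2" | "t = length x + 3"
    by linarith
  then show ?case
  proof cases
    case 1
    then have d: "d = Config (tape (\<lambda>_. 0) x w) (int (length w)) q_init" "length w = t"
      using cases w by auto
    show ?thesis
    proof (cases "t < length x")
      case True
      then obtain g where "c = Config (tape (\<lambda>_. 0) x (w @ [g])) (int (length w) + 1) q_init"
        using guess_init_step[of A x w c] step d by auto
      then show ?thesis using True d(2) by (intro exI[of _ "w @ [g]"]) auto
    next
      case False
      then have "c = Config (tape (\<lambda>_. 0) x w) (int (length w) + 1) q_query"
        using guess_init_step[of A x w c] step d 1 by auto
      then show ?thesis using False 1 d(2) by (intro exI[of _ w]) auto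
    qed
  next
    case 2
    then have "d = Config (tape (\<lambda>_. 0) x w) (int (length x) + 1) q_query" using cases by auto
    with step have "c = Config (tape (\<lambda>_. 0) x w) (int (length x) + 1) (if oracle_mem A w then q_yes else q_no)"
      by (auto elim!: otm_step.cases)
    then show ?thesis using 2 w by (intro exI[of _ w]) auto
  next
    case 3
    then have d: "d = Config (tape (\<lambda>_. 0) x w) (int (length x) + 1) (if oracle_mem A w then q_yes else q_no)"
      using cases by auto
    with step have "tm_step guess_rules d c" by (auto elim!: otm_step.cases split: if_splits)
    with d have "state_of c = q_final \<and> oracle_mem A w"
      by (auto elim!: tm_step.cases simp: guess_rules_def split: if_splits)
    then show ?thesis using 3 w by (intro exI[of _ w]) auto
  next
    case 4
    then have "state_of d = q_final" using cases by auto
    with step show ?thesis using otm_step_cases tm_step_final by fastforce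
  qed
qed

lemma guess_accept:
  assumes "length w = length x" "oracle_mem A w"
  shows "\<exists>c. (otm_step guess_rules A)\<^sup>*\<^sup>* (init_config x) c \<and> state_of c = q_final"
proof -
  let ?c = "\<lambda>v. Config (tape (\<lambda>_. 0) x v) (int (length v)) q_init"
  have "(otm_step guess_rules A)\<^sup>*\<^sup>* (init_config x) (?c (take j w))" if "j \<le> length w" for j
    using that
  proof (induction j)
    case 0
    then show ?case by (simp add: init_config_def init_tape_eq)
  next
    case (Suc j)
    let ?v = "take j w"
    have v: "length ?v = j" using Suc.prems by simp
    have T: "tape (\<lambda>_. 0) x ?v (int j) = Sym (Some (x ! j)) None None 0"
      using Suc.prems assms(1) v by (simp add: tape_def)
    have "tm_step guess_rules (?c ?v)
        (Config ((tape (\<lambda>_. 0) x ?v)(int j := Sym (Some (x ! j)) (Some (w ! j)) None 0))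
          (int j + shift MoveR) q_init)"
      unfolding v by (rule tm_step.intros) (auto simp: guess_rules_def T image_iff)
    also have "(tape (\<lambda>_. 0) x ?v)(int j := Sym (Some (x ! j)) (Some (w ! j)) None 0) =
        tape (\<lambda>_. 0) x (take (Suc j) w)"
      using tape_snoc[of "\<lambda>_. 0" x ?v "w ! j" 0] Suc.prems assms(1) v
      by (simp add: take_Suc_conv_app_nth fun_upd_idem)
    finally have "otm_step guess_rules A (?c ?v) (?c (take (Suc j) w))"
      using Suc.prems by (intro otm_step.intros) (auto simp: add.commute)
    with Suc show ?case by (meson Suc_leD rtranclp.rtrancl_into_rtrancl)
  qed
  from this[of "length w"] have "(otm_step guess_rules A)\<^sup>*\<^sup>* (init_config x) (?c w)" by simp
  also have "otm_step guess_rules A (?c w) (Config ((tape (\<lambda>_. 0) x w)(int (length w) := blank)) (int (length w) + shift MoveR) q_query)"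
    by (intro otm_step.intros tm_step.intros) (auto simp: guess_rules_def assms tape_def blank_def)
  also have "(tape (\<lambda>_. 0) x w)(int (length w) := blank) = tape (\<lambda>_. 0) x w"
    by (auto simp: assms tape_def blank_def fun_eq_iff)
  also have "otm_step guess_rules A (Config (tape (\<lambda>_. 0) x w) (int (length w) + shift MoveR) q_query)
     (Config (tape (\<lambda>_. 0) x w) (int (length w) + shift MoveR) q_yes)"
    using otm_step.intros(2)[of guess_rules A "tape (\<lambda>_. 0) x w"] assms by simp
  also have "otm_step guess_rules A (Config (tape (\<lambda>_. 0) x w) (int (length w) + shift MoveR) q_yes)
     (Config ((tape (\<lambda>_. 0) x w)(int (length w) + shift MoveR := blank)) (int (length w) + shift MoveR + shift MoveR) q_final)"
    using assms by (intro otm_step.intros tm_step.intros)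
      (auto simp: guess_rules_def assms tape_def blank_def opt_nth_def)
  finally show ?thesis by force
qed

lemma sep_lang_NP: "sep_lang A \<in> NP A"
proof -
  have "finite guess_rules" by (simp add: guess_rules_def)
  moreover have "\<nexists>c. (otm_step guess_rules A ^^ Suc (poly [:3, 1:] (length x))) (init_config x) c" for x
    using guess_run[of "Suc (poly [:3, 1:] (length x))" A x] by (auto split: if_splits)
  moreover have "x \<in> sep_lang A \<longleftrightarrow>
      (\<exists>c. (otm_step guess_rules A)\<^sup>*\<^sup>* (init_config x) c \<and> state_of c = q_final)" (is "?l \<longleftrightarrow> ?r") for x
  proof
    assume ?l
    then show ?r using guess_accept by (auto simp: sep_lang_def)
  next
    assume ?r
    then obtain t c where "(otm_step guess_rules A ^^ t) (init_config x) c" "state_of c = q_final"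
      by (auto simp: rtranclp_power)
    with guess_run[of t A x c] show ?l
      by (auto simp: sep_lang_def split: if_splits)
  qed
  ultimately show ?thesis unfolding NP_def by blast
qed

section \<open>Finite superpositions\<close>

definition snorm :: "superpos \<Rightarrow> real" where
  "snorm \<psi> = sqrt (sq_norm \<psi>)"

definition proj :: "(config \<Rightarrow> bool) \<Rightarrow> superpos \<Rightarrow> superpos" where
  "proj P \<psi> = (\<lambda>c. if P c then \<psi> c else 0)"

lemma sq_norm_superset:
  assumes "finite S" "supp \<psi> \<subseteq> S"
  shows "sq_norm \<psi> = (\<Sum>c\<in>S. (cmod (\<psi> c))\<^sup>2)"
  unfolding sq_norm_def using assms by (intro sum.mono_neutral_left) (auto simp: supp_def)

lemma snorm_superset:
  assumes "finite S" "supp \<psi> \<subseteq> S"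
  shows "snorm \<psi> = L2_set (\<lambda>c. cmod (\<psi> c)) S"
  using sq_norm_superset[OF assms] by (simp add: snorm_def L2_set_def)

lemma sq_norm_nonneg: "0 \<le> sq_norm \<psi>"
  by (simp add: sq_norm_def sum_nonneg)

lemma snorm_nonneg: "0 \<le> snorm \<psi>"
  by (simp add: snorm_def sq_norm_nonneg)

lemma snorm_power2: "(snorm \<psi>)\<^sup>2 = sq_norm \<psi>"
  by (simp add: snorm_def sq_norm_nonneg)

lemma supp_plus: "supp (\<lambda>c. \<psi> c + \<phi> c) \<subseteq> supp \<psi> \<union> supp \<phi>"
  by (auto simp: supp_def)

lemma supp_minus: "supp (\<lambda>c. \<psi> c - \<phi> c) \<subseteq> supp \<psi> \<union> supp \<phi>"
  by (auto simp: supp_def)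

lemma supp_proj: "supp (proj P \<psi>) = {c \<in> supp \<psi>. P c}"
  by (auto simp: supp_def proj_def)

lemma snorm_triangle:
  assumes "finite (supp \<psi>)" "finite (supp \<phi>)"
  shows "snorm (\<lambda>c. \<psi> c + \<phi> c) \<le> snorm \<psi> + snorm \<phi>"
proof -
  let ?S = "supp \<psi> \<union> supp \<phi>"
  have "snorm (\<lambda>c. \<psi> c + \<phi> c) = L2_set (\<lambda>c. cmod (\<psi> c + \<phi> c)) ?S"
    using assms by (intro snorm_superset supp_plus) auto
  also have "\<dots> \<le> L2_set (\<lambda>c. cmod (\<psi> c) + cmod (\<phi> c)) ?S"
    by (intro L2_set_mono norm_triangle_ineq norm_ge_zero)
  also have "\<dots> \<le> L2_set (\<lambda>c. cmod (\<psi> c)) ?S + L2_set (\<lambda>c. cmod (\<phi> c)) ?S"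
    by (rule L2_set_triangle_ineq)
  also have "\<dots> = snorm \<psi> + snorm \<phi>"
    using assms by (simp add: snorm_superset[of ?S])
  finally show ?thesis .
qed

lemma snorm_uminus: "snorm (\<lambda>c. - \<psi> c) = snorm \<psi>"
  by (simp add: snorm_def sq_norm_def supp_def)

lemma snorm_diff_triangle:
  assumes "finite (supp \<psi>)" "finite (supp \<phi>)"
  shows "snorm (\<lambda>c. \<psi> c - \<phi> c) \<le> snorm \<psi> + snorm \<phi>"
  using snorm_triangle[of \<psi> "\<lambda>c. - \<phi> c"] assms by (simp add: snorm_uminus) (simp add: supp_def)

lemma sq_norm_proj_le:
  assumes "finite (supp \<psi>)"
  shows "sq_norm (proj P \<psi>) \<le> sq_norm \<psi>"
proof -
  have "sq_norm (proj P \<psi>) = (\<Sum>c\<in>supp \<psi>. (cmod (proj P \<psi> c))\<^sup>2)"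
    using assms by (intro sq_norm_superset) (auto simp: supp_proj)
  also have "\<dots> \<le> sq_norm \<psi>"
    unfolding sq_norm_def by (intro sum_mono) (auto simp: proj_def)
  finally show ?thesis .
qed

lemma snorm_proj_le:
  assumes "finite (supp \<psi>)"
  shows "snorm (proj P \<psi>) \<le> snorm \<psi>"
  using sq_norm_proj_le[OF assms] by (simp add: snorm_def)

lemma superpositions_diff:
  "\<psi> \<in> superpositions M \<Longrightarrow> \<phi> \<in> superpositions M \<Longrightarrow> (\<lambda>c. \<psi> c - \<phi> c) \<in> superpositions M"
  using supp_minus[of \<psi> \<phi>] unfolding superpositions_def
  by (auto intro: finite_subset[OF supp_minus])

lemma superpositions_proj: "\<psi> \<in> superpositions M \<Longrightarrow> proj P \<psi> \<in> superpositions M"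
  by (auto simp: superpositions_def supp_proj)

section \<open>The evolution of a quantum machine\<close>

lemma evolve_superset:
  assumes "finite S" "supp \<psi> \<subseteq> S"
  shows "evolve M A \<psi> c' = (\<Sum>c\<in>S. \<psi> c * step_amp M A c c')"
  unfolding evolve_def using assms by (intro sum.mono_neutral_left) (auto simp: supp_def)

lemma evolve_diff:
  assumes "finite (supp \<psi>)" "finite (supp \<phi>)"
  shows "evolve M A (\<lambda>c. \<psi> c - \<phi> c) = (\<lambda>c. evolve M A \<psi> c - evolve M A \<phi> c)"
proof
  fix c'
  let ?S = "supp \<psi> \<union> supp \<phi>"
  have "finite ?S" using assms by simp
  then show "evolve M A (\<lambda>c. \<psi> c - \<phi> c) c' = evolve M A \<psi> c' - evolve M A \<phi> c'"
    using supp_minus[of \<psi> \<phi>]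
    by (simp add: evolve_superset[of ?S] left_diff_distrib flip: sum_subtractf)
qed

lemma query_tape_configs:
  assumes "Config T h q \<in> configs M" "q' < n_states M"
  shows "Config (query_tape A T) h q' \<in> configs M"
proof -
  have *: "work (set_qry b s) = work s" for b s by (cases s) auto
  let ?e = "Max (query_cells T)" let ?s = "set_qry (last (query_string T) \<noteq> oracle_mem A (butlast (query_string T))) (T ?e)"
  have "query_tape A T = T \<or> query_tape A T = T(?e := ?s)"
    by (simp add: query_tape_def Let_def)
  moreover have "?s \<in> alphabet M"
    using assms by (auto simp: * configs_def alphabet_def)
  ultimately obtain e s where "query_tape A T = T \<or> query_tape A T = T(e := s) \<and> s \<in> alphabet M"
    by blast
  moreover have "{i. (T(e := s)) i \<noteq> blank} \<subseteq> insert e {i. T i \<noteq> blank}" by auto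
  ultimately show ?thesis
    using assms unfolding configs_def
    by (auto intro: finite_subset[of _ "insert e {i. T i \<noteq> blank}"] simp del: fun_upd_apply)
       (auto split: if_splits)
qed

lemma step_amp_move:
  assumes "q \<noteq> q_query"
  shows "step_amp M A (Config T h q) (Config (T(h := s)) h' q') =
    (if h' = h - 1 then delta M q (T h) s q' MoveL else 0) +
    (if h' = h + 1 then delta M q (T h) s q' MoveR else 0)"
proof -
  have "\<exists>s'. T(h := s) = T(h := s')" by blast
  then show ?thesis using assms by (simp add: step_amp_def)
qed

lemma step_amp_support:
  assumes M: "is_qtm M" and c: "c \<in> configs M"
  shows "finite {c'. step_amp M A c c' \<noteq> 0} \<and> {c'. step_amp M A c c' \<noteq> 0} \<subseteq> configs M"
proof -
  obtain T h q where c': "c = Config T h q" by (cases c)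
  show ?thesis
  proof (cases "q = q_query")
    case True
    then have "{c'. step_amp M A c c' \<noteq> 0} \<subseteq> {Config (query_tape A T) h q_post}"
      by (auto simp: step_amp_def c')
    moreover have "Config (query_tape A T) h q_post \<in> configs M"
      using c M unfolding c' by (intro query_tape_configs) (auto simp: is_qtm_def)
    ultimately show ?thesis by (auto intro: finite_subset)
  next
    case False
    let ?f = "\<lambda>(s, d, q'). Config (T(h := s)) (h + shift d) q'"
    let ?I = "alphabet M \<times> {MoveL, MoveR} \<times> {..<n_states M}"
    have "{c'. step_amp M A c c' \<noteq> 0} \<subseteq> ?f ` ?I"
    proof
      fix d assume "d \<in> {c'. step_amp M A c c' \<noteq> 0}"
      then have nz: "step_amp M A c d \<noteq> 0" by simp
      then obtain s where s: "tape_of d = T(h := s)"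
        using False by (auto simp: step_amp_def c' split: if_splits)
      obtain h' q' where d: "d = Config (T(h := s)) h' q'" using s by (cases d) auto
      have "\<exists>e \<in> {MoveL, MoveR}. head_of d = h + shift e \<and> delta M q (T h) s (state_of d) e \<noteq> 0"
        using nz unfolding d c' step_amp_move[OF False] by (simp split: if_splits)
      then obtain e where "e \<in> {MoveL, MoveR}" "head_of d = h + shift e"
        "delta M q (T h) s (state_of d) e \<noteq> 0" by blast
      moreover from this M have "s \<in> alphabet M" "state_of d < n_states M"
        unfolding is_qtm_def by blast+
      ultimately show "d \<in> ?f ` ?I"
        using s by (cases d) (auto simp: image_iff)
    qed
    moreover have "finite (?f ` ?I)" using finite_alphabet by simp
    moreover have "?f ` ?I \<subseteq> configs M"
    proof clarsimp
      fix s d q' assume *: "s \<in> alphabet M" "d = MoveL \<or> d = MoveR" "q' < n_states M"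
      have "{i. (T(h := s)) i \<noteq> blank} \<subseteq> insert h {i. T i \<noteq> blank}" by auto
      moreover have "finite (insert h {i. T i \<noteq> blank})" using c by (simp add: c' configs_def)
      ultimately have "finite {i. (T(h := s)) i \<noteq> blank}" by (rule finite_subset)
      then show "Config (T(h := s)) (h + shift d) q' \<in> configs M"
        using * c by (auto simp: c' configs_def simp del: fun_upd_apply) (auto split: if_splits)
    qed
    ultimately show ?thesis using finite_subset by blast
  qed
qed

lemma evolve_superpositions:
  assumes "is_qtm M" "\<psi> \<in> superpositions M"
  shows "evolve M A \<psi> \<in> superpositions M"
proof -
  let ?U = "\<Union>c\<in>supp \<psi>. {c'. step_amp M A c c' \<noteq> 0}"
  have "supp (evolve M A \<psi>) \<subseteq> ?U"
  proof
    fix c' assume "c' \<in> supp (evolve M A \<psi>)"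
    then have "(\<Sum>c\<in>supp \<psi>. \<psi> c * step_amp M A c c') \<noteq> 0"
      by (simp add: supp_def evolve_def)
    then obtain c where "c \<in> supp \<psi>" "\<psi> c * step_amp M A c c' \<noteq> 0"
      by (meson sum.neutral)
    then show "c' \<in> ?U" by auto
  qed
  moreover have "finite ?U \<and> ?U \<subseteq> configs M"
    using assms(2) step_amp_support[OF assms(1)] unfolding superpositions_def by blast
  ultimately show ?thesis unfolding superpositions_def by (auto intro: finite_subset)
qed

lemma init_config_configs:
  assumes "is_qtm M"
  shows "init_config x \<in> configs M"
proof -
  have "{i. init_tape x i \<noteq> blank} \<subseteq> {0..<int (length x)}"
    by (auto simp: init_tape_def)
  then have "finite {i. init_tape x i \<noteq> blank}" by (rule finite_subset) simp
  then show ?thesis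
    using assms by (auto simp: configs_def init_config_def is_qtm_def alphabet_def init_tape_def blank_def)
qed

lemma run_0: "run M A x 0 = (\<lambda>c. if c = init_config x then 1 else 0)"
  by (simp add: run_def)

lemma run_Suc: "run M A x (Suc t) = evolve M A (run M A x t)"
  by (simp add: run_def)

lemma run_superpositions:
  assumes "is_qtm M"
  shows "run M A x t \<in> superpositions M"
proof (induction t)
  case 0
  have "supp (run M A x 0) = {init_config x}" by (auto simp: supp_def run_0)
  then show ?case using init_config_configs[OF assms] by (simp add: superpositions_def)
next
  case (Suc t)
  then show ?case by (simp add: run_Suc evolve_superpositions assms)
qed

lemma finite_supp_run: "is_qtm M \<Longrightarrow> finite (supp (run M A x t))"
  using run_superpositions by (auto simp: superpositions_def)

lemma snorm_evolve:
  "well_formed M \<Longrightarrow> \<psi> \<in> superpositions M \<Longrightarrow> snorm (evolve M A \<psi>) = snorm \<psi>"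
  by (simp add: well_formed_def snorm_def)

lemma sq_norm_run:
  assumes "is_qtm M" "well_formed M"
  shows "sq_norm (run M A x t) = 1"
proof (induction t)
  case 0
  have "supp (run M A x 0) = {init_config x}" by (auto simp: supp_def run_0)
  then show ?case by (simp add: sq_norm_def run_0)
next
  case (Suc t)
  then show ?case
    using assms run_superpositions[OF assms(1)] by (simp add: run_Suc well_formed_def)
qed

section \<open>Dependence on the oracle\<close>

text \<open>The last bit \<open>b\<close> is the target bit and not part of the question. An empty
  query string, being a no-op, matches no \<open>w\<close>.\<close>

definition query_on :: "bool list \<Rightarrow> config \<Rightarrow> bool" where
  "query_on w c \<longleftrightarrow> state_of c = q_query \<and> (\<exists>b. query_string (tape_of c) = w @ [b])"

lemma query_on_unique: "query_on w c \<Longrightarrow> w = butlast (query_string (tape_of c))"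
  by (auto simp: query_on_def)

lemma step_amp_cong:
  assumes "\<And>w. query_on w c \<Longrightarrow> oracle_mem A w = oracle_mem B w"
  shows "step_amp M A c = step_amp M B c"
proof (cases "state_of c = q_query")
  case True
  have "query_tape A (tape_of c) = query_tape B (tape_of c)"
  proof (cases "query_string (tape_of c)" rule: rev_cases)
    case Nil
    then show ?thesis by (simp add: query_tape_def)
  next
    case (snoc w b)
    then have "oracle_mem A w = oracle_mem B w"
      using True assms by (auto simp: query_on_def)
    with snoc show ?thesis by (simp add: query_tape_def)
  qed
  then show ?thesis by (simp add: step_amp_def fun_eq_iff True)
qed (simp add: step_amp_def fun_eq_iff)

lemma evolve_cong:
  assumes "\<And>c w. c \<in> supp \<psi> \<Longrightarrow> query_on w c \<Longrightarrow> oracle_mem A w = oracle_mem B w"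
  shows "evolve M A \<psi> = evolve M B \<psi>"
  unfolding evolve_def using step_amp_cong[of _ A B M] assms by (intro ext sum.cong) auto

lemma run_cong:
  assumes "\<And>s c w. s < t \<Longrightarrow> c \<in> supp (run M A x s) \<Longrightarrow> query_on w c \<Longrightarrow> oracle_mem A w = oracle_mem B w"
  shows "run M B x t = run M A x t"
  using assms
proof (induction t)
  case (Suc t)
  have "run M B x t = run M A x t"
    by (rule Suc.IH) (rule Suc.prems, auto)
  moreover have "evolve M A (run M A x t) = evolve M B (run M A x t)"
    by (rule evolve_cong, rule Suc.prems) auto
  ultimately show ?case by (simp add: run_Suc)
qed (simp add: run_0)

text \<open>Up to time \<open>T\<close> only finitely many configurations carry amplitude, and each
  queries at most one string; the run depends on the oracle at these strings only. This is what
  makes failure of a machine an open condition.\<close>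

lemma run_local:
  assumes "is_qtm M"
  shows "\<exists>N. \<forall>B. (\<forall>i<N. B i = A i) \<longrightarrow> (\<forall>t\<le>T. run M B x t = run M A x t)"
proof -
  let ?W = "{w. \<exists>s<T. \<exists>c\<in>supp (run M A x s). query_on w c}"
  have "?W \<subseteq> (\<lambda>c. butlast (query_string (tape_of c))) ` (\<Union>s<T. supp (run M A x s))"
    using query_on_unique by blast
  then have "finite ?W"
    by (rule finite_subset) (auto intro: finite_supp_run assms)
  then have "finite (str_num ` ?W)" by simp
  then obtain N where N: "\<forall>i\<in>str_num ` ?W. i < N"
    using finite_nat_set_iff_bounded by blast
  have "run M B x t = run M A x t" if "\<forall>i<N. B i = A i" "t \<le> T" for B t
  proof (rule run_cong)
    fix s c w assume "s < t" "c \<in> supp (run M A x s)" "query_on w c"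
    moreover from this have "s < T" using that(2) by simp
    ultimately have "w \<in> ?W" by blast
    then show "oracle_mem A w = oracle_mem B w" using N that(1) by simp
  qed
  then show ?thesis by blast
qed

section \<open>The hybrid argument\<close>

text \<open>Only the part \<open>?p\<close> of the state that queries \<open>w\<close> evolves
  differently under the two oracles. In each step the old error is carried along isometrically by
  the evolution under \<open>B\<close>, and \<open>?p\<close> adds at most its norm once for each
  oracle, whence the factor 2. The bound refers to the run under \<open>A\<close> alone, so
  \<open>w\<close> can be chosen before \<open>B\<close>.\<close>

lemma hybrid:
  assumes M: "is_qtm M" "well_formed M"
    and AB: "\<And>v. v \<noteq> w \<Longrightarrow> oracle_mem A v = oracle_mem B v"
  shows "snorm (\<lambda>c. run M B x t c - run M A x t c) \<le> 2 * (\<Sum>s<t. snorm (proj (query_on w) (run M A x s)))"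
proof (induction t)
  case 0
  then show ?case by (simp add: run_0 snorm_def sq_norm_def supp_def)
next
  case (Suc t)
  let ?a = "run M A x t" and ?b = "run M B x t"
  let ?p = "proj (query_on w) ?a" and ?n = "proj (\<lambda>c. \<not> query_on w c) ?a"
  have sup: "?a \<in> superpositions M" "?b \<in> superpositions M" "?p \<in> superpositions M" "?n \<in> superpositions M"
    by (simp_all add: run_superpositions superpositions_proj M)
  then have fin: "finite (supp ?a)" "finite (supp ?b)" "finite (supp ?p)" "finite (supp ?n)"
    by (auto simp: superpositions_def)
  have finE: "finite (supp (evolve M D \<psi>))" if "\<psi> \<in> superpositions M" for D \<psi>
    using evolve_superpositions[OF M(1) that] by (simp add: superpositions_def)
  have same: "evolve M B ?n = evolve M A ?n"
    by (rule evolve_cong, rule AB[symmetric]) (auto simp: supp_proj)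
  have n: "?n = (\<lambda>c. ?a c - ?p c)" by (auto simp: proj_def)
  have eq: "evolve M B ?a c - evolve M A ?a c = evolve M B ?p c - evolve M A ?p c" for c
    using fun_cong[OF same[unfolded n evolve_diff[OF fin(1,3)]], of c] by (simp add: algebra_simps)
  have "(\<lambda>c. run M B x (Suc t) c - run M A x (Suc t) c) =
      (\<lambda>c. evolve M B (\<lambda>c. ?b c - ?a c) c + (evolve M B ?p c - evolve M A ?p c))"
    unfolding run_Suc evolve_diff[OF fin(2,1)] eq[symmetric] by simp
  then have "snorm (\<lambda>c. run M B x (Suc t) c - run M A x (Suc t) c) \<le>
      snorm (evolve M B (\<lambda>c. ?b c - ?a c)) + snorm (\<lambda>c. evolve M B ?p c - evolve M A ?p c)"
    using snorm_triangle[OF finE[OF superpositions_diff[OF sup(2,1)], of B]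
      finite_subset[OF supp_minus finite_UnI[OF finE[OF sup(3), of B] finE[OF sup(3), of A]]]]
    by simp
  moreover have "snorm (evolve M B (\<lambda>c. ?b c - ?a c)) = snorm (\<lambda>c. ?b c - ?a c)"
    by (rule snorm_evolve[OF M(2) superpositions_diff[OF sup(2,1)]])
  moreover have "snorm (\<lambda>c. evolve M B ?p c - evolve M A ?p c) \<le> snorm (evolve M B ?p) + snorm (evolve M A ?p)"
    by (rule snorm_diff_triangle[OF finE[OF sup(3)] finE[OF sup(3)]])
  moreover have "snorm (evolve M B ?p) = snorm ?p" "snorm (evolve M A ?p) = snorm ?p"
    by (rule snorm_evolve[OF M(2) sup(3)])+
  ultimately show ?case using Suc.IH by simp
qed

lemma card_bool_lists: "card {w :: bool list. length w = n} = 2 ^ n"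
  using card_lists_length_eq[of "UNIV :: bool set" n] by simp

lemma finite_bool_lists: "finite {w :: bool list. length w = n}"
  using finite_lists_length_eq[of "UNIV :: bool set" n] by simp

text \<open>A configuration queries at most one string, so after exchanging the sums it is counted
  at most once.\<close>

lemma query_weight_sum:
  assumes "finite (supp \<psi>)"
  shows "(\<Sum>w\<in>{w. length w = n}. sq_norm (proj (query_on w) \<psi>)) \<le> sq_norm \<psi>"
proof -
  let ?W = "{w :: bool list. length w = n}"
  have "(\<Sum>w\<in>?W. sq_norm (proj (query_on w) \<psi>)) =
      (\<Sum>w\<in>?W. \<Sum>c\<in>supp \<psi>. if query_on w c then (cmod (\<psi> c))\<^sup>2 else 0)"
  proof (rule sum.cong[OF refl])
    fix w
    have "sq_norm (proj (query_on w) \<psi>) = (\<Sum>c\<in>supp \<psi>. (cmod (proj (query_on w) \<psi> c))\<^sup>2)"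
      using assms by (intro sq_norm_superset) (auto simp: supp_proj)
    also have "\<dots> = (\<Sum>c\<in>supp \<psi>. if query_on w c then (cmod (\<psi> c))\<^sup>2 else 0)"
      by (intro sum.cong) (auto simp: proj_def)
    finally show "sq_norm (proj (query_on w) \<psi>) = \<dots>" .
  qed
  also have "\<dots> = (\<Sum>c\<in>supp \<psi>. \<Sum>w\<in>?W. if query_on w c then (cmod (\<psi> c))\<^sup>2 else 0)"
    by (rule sum.swap)
  also have "\<dots> \<le> (\<Sum>c\<in>supp \<psi>. (cmod (\<psi> c))\<^sup>2)"
  proof (rule sum_mono)
    fix c
    let ?u = "butlast (query_string (tape_of c))"
    have "(\<Sum>w\<in>?W. if query_on w c then (cmod (\<psi> c))\<^sup>2 else 0) \<le>
        (\<Sum>w\<in>?W. if w = ?u then (cmod (\<psi> c))\<^sup>2 else 0)"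
      by (intro sum_mono) (auto dest: query_on_unique)
    also have "\<dots> \<le> (cmod (\<psi> c))\<^sup>2"
      using finite_bool_lists[of n] by simp
    finally show "(\<Sum>w\<in>?W. if query_on w c then (cmod (\<psi> c))\<^sup>2 else 0) \<le> (cmod (\<psi> c))\<^sup>2" .
  qed
  finally show ?thesis by (simp add: sq_norm_def)
qed

text \<open>The squared query weights over all \<open>T\<close> steps and all \<open>2 ^ n\<close>
  strings add up to at most \<open>T\<close>, so some string receives at most the average
  \<open>T / 2 ^ n\<close>. Cauchy-Schwarz turns this bound on the sum of squares into the bound
  \<open>T / sqrt (2 ^ n)\<close> on the sum that occurs in the hybrid estimate.\<close>

lemma light_query:
  assumes M: "is_qtm M" "well_formed M"
  shows "\<exists>w. length w = n \<and> (\<forall>t\<le>T. \<forall>B. (\<forall>v. v \<noteq> w \<longrightarrow> oracle_mem A v = oracle_mem B v) \<longrightarrow>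
     snorm (\<lambda>c. run M B x t c - run M A x t c) \<le> 2 * real T / sqrt (2 ^ n))"
proof -
  let ?W = "{w :: bool list. length w = n}"
  define a where "a w s = snorm (proj (query_on w) (run M A x s))" for w s
  have "\<exists>w\<in>?W. (\<Sum>s<T. (a w s)\<^sup>2) \<le> real T / 2 ^ n"
  proof (rule ccontr)
    assume "\<not> ?thesis"
    then have "(\<Sum>w\<in>?W. real T / 2 ^ n) < (\<Sum>w\<in>?W. \<Sum>s<T. (a w s)\<^sup>2)"
      using finite_bool_lists[of n] by (intro sum_strict_mono) (auto simp: not_le intro: exI[of _ "replicate n True"])
    also have "\<dots> = (\<Sum>s<T. \<Sum>w\<in>?W. (a w s)\<^sup>2)" by (rule sum.swap)
    also have "\<dots> \<le> (\<Sum>s<T. sq_norm (run M A x s))"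
      unfolding a_def snorm_power2
      by (intro sum_mono query_weight_sum finite_supp_run M)
    also have "\<dots> = real T" by (simp add: sq_norm_run M)
    finally show False by (simp add: card_bool_lists)
  qed
  then obtain w where w: "length w = n" "(\<Sum>s<T. (a w s)\<^sup>2) \<le> real T / 2 ^ n" by blast
  have "snorm (\<lambda>c. run M B x t c - run M A x t c) \<le> 2 * real T / sqrt (2 ^ n)"
    if "t \<le> T" and B: "\<forall>v. v \<noteq> w \<longrightarrow> oracle_mem A v = oracle_mem B v" for t B
  proof -
    have "snorm (\<lambda>c. run M B x t c - run M A x t c) \<le> 2 * (\<Sum>s<t. a w s)"
      unfolding a_def using M B by (intro hybrid) auto
    also have "(\<Sum>s<t. a w s) \<le> (\<Sum>s<T. a w s)"
      using that(1) by (intro sum_mono2) (auto simp: a_def snorm_nonneg)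
    also have "(\<Sum>s<T. a w s) \<le> real T / sqrt (2 ^ n)"
    proof (rule power2_le_imp_le)
      have "(\<Sum>s<T. a w s)\<^sup>2 \<le> (\<Sum>s<T. (a w s)\<^sup>2) * real T"
        using sum_squared_le_sum_of_squares[of "a w" "{..<T}"] by simp
      also have "\<dots> \<le> real T / 2 ^ n * real T"
        using w(2) by (intro mult_right_mono) auto
      also have "\<dots> = (real T / sqrt (2 ^ n))\<^sup>2"
        by (simp add: power_divide power2_eq_square)
      finally show "(\<Sum>s<T. a w s)\<^sup>2 \<le> (real T / sqrt (2 ^ n))\<^sup>2" .
    qed simp
    finally show ?thesis by simp
  qed
  with w(1) show ?thesis by blast
qed

section \<open>Generic oracles\<close>

definition decides :: "qtm \<Rightarrow> cantor \<Rightarrow> nat \<Rightarrow> bool list \<Rightarrow> bool \<Rightarrow> bool" where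
  "decides M A n x b \<longleftrightarrow> (\<exists>T\<le>n. halts_at M A x T \<and>
        (\<forall>c \<in> supp (run M A x T). head_of c = 0) \<and>
        (b \<longrightarrow> accept_prob (run M A x T) \<ge> 2 / 3) \<and>
        (\<not> b \<longrightarrow> 1 - accept_prob (run M A x T) \<ge> 2 / 3))"

lemma BQP_iff:
  "L \<in> BQP A \<longleftrightarrow> (\<exists>M p. is_qtm M \<and> well_formed M \<and> normal_form M \<and>
     (\<forall>x. decides M A (poly p (length x)) x (x \<in> L)))"
  by (simp add: BQP_def decides_def)

lemma accept_prob_proj:
  "accept_prob \<psi> = sq_norm (proj (\<lambda>c. outp (tape_of c 0) = Some True) \<psi>)"
  unfolding accept_prob_def sq_norm_def supp_proj by (intro sum.cong) (auto simp: proj_def)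

lemma proj_diff: "proj P (\<lambda>c. \<psi> c - \<phi> c) = (\<lambda>c. proj P \<psi> c - proj P \<phi> c)"
  by (auto simp: proj_def)

lemma proj_id: "supp \<psi> \<subseteq> Collect P \<Longrightarrow> proj P \<psi> = \<psi>"
  by (rule ext) (auto simp: proj_def supp_def)

lemma proj_0: "supp \<psi> \<inter> Collect P = {} \<Longrightarrow> proj P \<psi> = (\<lambda>_. 0)"
  by (rule ext) (auto simp: proj_def supp_def)

text \<open>The halting time may depend on the oracle. If the times differ, then at the earlier one
  the first run is entirely in the final state and the other not at all, so projecting to that state
  gives distance 1. If they agree, the norms of the accepting parts would have to differ by more
  than 1/5.\<close>

lemma decides_close:
  assumes M: "is_qtm M" "well_formed M"
    and close: "\<And>t. t \<le> n \<Longrightarrow> snorm (\<lambda>c. run M B x t c - run M A x t c) < 1 / 5"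
    and A: "decides M A n x False"
  shows "\<not> decides M B n x True"
proof
  assume B: "decides M B n x True"
  let ?fin = "\<lambda>c. state_of c = q_final" and ?acc = "\<lambda>c. outp (tape_of c 0) = Some True"
  from A obtain S where S: "S \<le> n" "halts_at M A x S" "accept_prob (run M A x S) \<le> 1 / 3"
    by (auto simp: decides_def)
  from B obtain T where T: "T \<le> n" "halts_at M B x T" "accept_prob (run M B x T) \<ge> 2 / 3"
    by (auto simp: decides_def)
  have fin: "finite (supp (run M D x t))" for D t by (rule finite_supp_run[OF M(1)])
  have norm1: "snorm (run M D x t) = 1" for D t by (simp add: snorm_def sq_norm_run M)
  have close': "snorm (\<lambda>c. proj P (run M B x t) c - proj P (run M A x t) c) < 1 / 5" if "t \<le> n" for P t
  proof -
    have "finite (supp (\<lambda>c. run M B x t c - run M A x t c))"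
      using fin by (auto intro: finite_subset[OF supp_minus])
    from snorm_proj_le[OF this, of P] close[OF that] show ?thesis by (simp add: proj_diff)
  qed
  consider "S < T" | "T < S" | "S = T" by linarith
  then show False
  proof cases
    case 1
    then have "proj ?fin (run M B x S) = (\<lambda>_. 0)" "proj ?fin (run M A x S) = run M A x S"
      using S(2) T(2) by (auto simp: halts_at_def intro!: proj_0 proj_id)
    with close'[OF S(1), of ?fin] show False by (simp add: norm1 snorm_uminus)
  next
    case 2
    then have "proj ?fin (run M A x T) = (\<lambda>_. 0)" "proj ?fin (run M B x T) = run M B x T"
      using S(2) T(2) by (auto simp: halts_at_def intro!: proj_0 proj_id)
    with close'[OF T(1), of ?fin] show False by (simp add: norm1)
  next
    case 3
    let ?a = "proj ?acc (run M A x T)" and ?b = "proj ?acc (run M B x T)"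
    have fin': "finite (supp ?a)" "finite (supp ?b)" using fin by (auto simp: supp_proj)
    have a: "(snorm ?a)\<^sup>2 \<le> 1 / 3" and b: "(snorm ?b)\<^sup>2 \<ge> 2 / 3"
      using S(3) T(3) 3 by (simp_all add: accept_prob_proj snorm_power2)
    have "?b = (\<lambda>c. ?a c + (?b c - ?a c))" by auto
    then have "snorm ?b \<le> snorm ?a + snorm (\<lambda>c. ?b c - ?a c)"
      using snorm_triangle[of ?a "\<lambda>c. ?b c - ?a c"] fin' finite_subset[OF supp_minus[of ?b ?a]] by simp
    with close'[OF T(1), of ?acc] have "snorm ?b < snorm ?a + 1 / 5" by simp
    \<comment> \<open>The constants fit because \<open>1 / 3 \<le> (3 / 5)\<^sup>2\<close> and
      \<open>(3 / 5 + 1 / 5)\<^sup>2 = 16 / 25 < 2 / 3\<close>.\<close>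
    moreover have "snorm ?a \<le> 3 / 5"
      by (rule power2_le_imp_le) (use a in \<open>auto simp: power2_eq_square\<close>)
    ultimately have "snorm ?b < 4 / 5" by simp
    then have "(snorm ?b)\<^sup>2 < (4 / 5)\<^sup>2"
      using snorm_nonneg by (intro power_strict_mono) auto
    with b show False by (simp add: power2_eq_square)
  qed
qed

lemma poly_below_exp:
  fixes p :: "nat poly"
  shows "(\<lambda>n. real (poly p n) / 2 ^ n) \<longlonglongrightarrow> 0"
proof -
  \<comment> \<open>The extra factor \<open>n ^ k\<close> makes the induction over the coefficients
    go through: splitting off the constant term leaves a polynomial multiplied by
    \<open>n\<close>.\<close>
  have "(\<lambda>n. real (poly p n) * real n ^ k / 2 ^ n) \<longlonglongrightarrow> 0" for k
  proof (induction p arbitrary: k)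
    case 0
    then show ?case by simp
  next
    case (pCons a p)
    have "(\<lambda>n. real n ^ k / 2 ^ n) \<longlonglongrightarrow> 0"
      by real_asymp
    then have "(\<lambda>n. real a * (real n ^ k / 2 ^ n) + real (poly p n) * real n ^ Suc k / 2 ^ n) \<longlonglongrightarrow> real a * 0 + 0"
      by (intro tendsto_intros pCons.IH)
    then show ?case by (simp add: algebra_simps add_divide_distrib)
  qed
  from this[of 0] show ?thesis by simp
qed

lemma poly_square_below_exp:
  fixes p :: "nat poly"
  shows "\<exists>n\<ge>N. 2 * real (poly p n) / sqrt (2 ^ n) < 1 / 5"
proof -
  have "(\<lambda>n. real (poly (p * p) n) / 2 ^ n) \<longlonglongrightarrow> 0" by (rule poly_below_exp)
  \<comment> \<open>Squaring the goal gives \<open>4 * p\<^sup>2 / 2 ^ n < 1 / 25\<close>, hence the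
    threshold 1/100.\<close>
  then have "eventually (\<lambda>n. real (poly (p * p) n) / 2 ^ n < 1 / 100) sequentially"
    by (rule order_tendstoD) simp
  then have "eventually (\<lambda>n. real (poly (p * p) n) / 2 ^ n < 1 / 100 \<and> N \<le> n) sequentially"
    using eventually_ge_at_top eventually_conj by blast
  then obtain n where n: "real (poly (p * p) n) / 2 ^ n < 1 / 100" "N \<le> n"
    using eventually_happens' sequentially_bot by blast
  have "(2 * real (poly p n) / sqrt (2 ^ n))\<^sup>2 < (1 / 5)\<^sup>2"
    using n(1) by (simp add: power_divide power_mult_distrib power2_eq_square)
  then have "2 * real (poly p n) / sqrt (2 ^ n) < 1 / 5"
    by (rule power2_less_imp_less) simp
  with n(2) show ?thesis by blast
qed

section \<open>The oracles on which a given machine errs form an open dense set\<close>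

definition failing :: "qtm \<Rightarrow> nat poly \<Rightarrow> cantor set" where
  "failing M p = {A. \<exists>x. \<not> decides M A (poly p (length x)) x (x \<in> sep_lang A)}"

text \<open>An error on one input \<open>x\<close> is witnessed by finitely many oracle bits: those
  queried within the time bound and those at the strings of length \<open>length x\<close>, which
  decide membership of \<open>x\<close> in \<open>sep_lang\<close>.\<close>

lemma open_failing:
  assumes "is_qtm M"
  shows "open (failing M p)"
proof (rule openI_cylinder)
  fix A assume "A \<in> failing M p"
  then obtain x where x: "\<not> decides M A (poly p (length x)) x (x \<in> sep_lang A)"
    by (auto simp: failing_def)
  obtain N where N: "\<And>B t. \<forall>i<N. B i = A i \<Longrightarrow> t \<le> poly p (length x) \<Longrightarrow> run M B x t = run M A x t"
    using run_local[OF assms, of A "poly p (length x)" x] by blast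
  have "finite (str_num ` {w. length w = length x})" by (simp add: finite_bool_lists)
  then obtain K where K: "\<forall>i\<in>str_num ` {w. length w = length x}. i < K"
    using finite_nat_set_iff_bounded by blast
  have "B \<in> failing M p" if "B \<in> cylinder (max N K) A" for B
  proof -
    from that have B: "\<forall>i<max N K. B i = A i" by (simp add: cylinder_def)
    have run: "run M B x t = run M A x t" if "t \<le> poly p (length x)" for t
      by (rule N[OF _ that]) (use B in auto)
    then have "decides M B (poly p (length x)) x b = decides M A (poly p (length x)) x b" for b
      unfolding decides_def halts_at_def by (simp cong: conj_cong)
    moreover have "x \<in> sep_lang B \<longleftrightarrow> x \<in> sep_lang A"
    proof -
      have "oracle_mem B w = oracle_mem A w" if "length w = length x" for w
        using B K that by (simp add: less_max_iff_disj)
      then show ?thesis by (auto simp: sep_lang_def)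
    qed
    ultimately have "\<not> decides M B (poly p (length x)) x (x \<in> sep_lang B)" using x by simp
    then show ?thesis unfolding failing_def by blast
  qed
  then show "\<exists>N. cylinder N A \<subseteq> failing M p" by blast
qed

text \<open>Every digit of the numeration is at least 1. The lemma serves to place long strings
  outside the first \<open>N\<close> bits of an oracle.\<close>

lemma length_le_str_num: "length w \<le> str_num w"
proof -
  have "length v \<le> horner_sum (\<lambda>b. if b then 2 else 1) (2 :: nat) v" for v
    by (induction v) auto
  from this[of "rev w"] show ?thesis by (simp add: str_num_def)
qed

lemma inj_str_num: "str_num v = str_num w \<longleftrightarrow> v = w"
  using bij_str_num by (auto simp: bij_def inj_def)

text \<open>Two oracles in the cylinder differ only at a lightly queried string \<open>w\<close> of
  length \<open>n\<close>, which puts \<open>x\<close> into the language for one and not for the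
  other. The machine cannot tell them apart, so it errs on at least one of them; which one does not
  matter.\<close>

lemma dense_failing:
  assumes M: "is_qtm M" "well_formed M"
  shows "cyl_dense (failing M p)"
  unfolding cyl_dense_def
proof (intro allI)
  fix N A
  obtain n where n: "n \<ge> N" "2 * real (poly p n) / sqrt (2 ^ n) < 1 / 5"
    using poly_square_below_exp by blast
  \<comment> \<open>Everything beyond the prescribed bits is cleared, so that no string of length
    \<open>n\<close> belongs to \<open>A0\<close> and adding \<open>w\<close> alone changes the
    answer.\<close>
  define A0 where "A0 = (\<lambda>i. i < N \<and> A i)"
  define x where "x = replicate n True"
  have x: "length x = n" by (simp add: x_def)
  have long: "\<not> str_num w < N" if "length w = n" for w
    using length_le_str_num[of w] that n(1) by simp
  obtain w where w: "length w = n" and close: "\<And>t B. t \<le> poly p n \<Longrightarrow>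
      (\<forall>v. v \<noteq> w \<longrightarrow> oracle_mem A0 v = oracle_mem B v) \<Longrightarrow>
      snorm (\<lambda>c. run M B x t c - run M A0 x t c) \<le> 2 * real (poly p n) / sqrt (2 ^ n)"
    using light_query[OF M, of n "poly p n" A0 x] by blast
  define B where "B = A0(str_num w := True)"
  have "A0 \<in> cylinder N A" "B \<in> cylinder N A"
    using long[OF w] by (auto simp: A0_def B_def cylinder_def)
  moreover have "x \<notin> sep_lang A0"
    using long by (auto simp: sep_lang_def A0_def x)
  moreover have "x \<in> sep_lang B"
    using w by (auto simp: sep_lang_def B_def x)
  moreover have "decides M A0 (poly p n) x False \<Longrightarrow> \<not> decides M B (poly p n) x True"
  proof (rule decides_close[OF M])
    fix t assume "t \<le> poly p n"
    then have "snorm (\<lambda>c. run M B x t c - run M A0 x t c) \<le> 2 * real (poly p n) / sqrt (2 ^ n)"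
      by (rule close) (simp add: B_def inj_str_num)
    with n(2) show "snorm (\<lambda>c. run M B x t c - run M A0 x t c) < 1 / 5" by linarith
  qed
  ultimately have "\<not> decides M A0 (poly p (length x)) x (x \<in> sep_lang A0) \<or>
      \<not> decides M B (poly p (length x)) x (x \<in> sep_lang B)"
    by (auto simp: x)
  then have "A0 \<in> failing M p \<or> B \<in> failing M p" unfolding failing_def by blast
  with \<open>A0 \<in> cylinder N A\<close> \<open>B \<in> cylinder N A\<close> show "\<exists>B\<in>failing M p. B \<in> cylinder N A"
    by blast
qed

definition generic_sets :: "cantor set set" where
  "generic_sets = (\<lambda>(M, p). failing M p) ` ({M. is_qtm M \<and> well_formed M} \<times> UNIV)"

lemma countable_generic_sets: "countable generic_sets"
proof -
  have "countable {M. is_qtm M \<and> well_formed M}"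
    by (rule countable_subset[OF _ countable_qtms]) auto
  then show ?thesis unfolding generic_sets_def by (intro countable_image countable_SIGMA) auto
qed

lemma generic_separates:
  assumes "A \<in> \<Inter>generic_sets"
  shows "\<not> NP A \<subseteq> BQP A"
proof
  assume "NP A \<subseteq> BQP A"
  then have "sep_lang A \<in> BQP A" using sep_lang_NP by blast
  then obtain M p where M: "is_qtm M" "well_formed M"
    "\<forall>x. decides M A (poly p (length x)) x (x \<in> sep_lang A)"
    unfolding BQP_iff by blast
  then have "failing M p \<in> generic_sets" by (auto simp: generic_sets_def)
  then have "A \<in> failing M p" using assms by blast
  with M(3) show False by (auto simp: failing_def)
qed

text \<open>If the set were a union of closed sets \<open>F n\<close>, each \<open>F n\<close> would
  miss the dense set of oracles with inclusion, so its complement would be open and dense. Baire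
  then gives an oracle that lies in all generic sets, hence in the union, but in no
  \<open>F n\<close>.\<close>

lemma not_fsigma_if_dense:
  assumes "cyl_dense {A. NP A \<subseteq> BQP A}"
  shows "\<not> fsigma {A. \<not> NP A \<subseteq> BQP A}"
proof
  assume "fsigma {A. \<not> NP A \<subseteq> BQP A}"
  then obtain F :: "nat \<Rightarrow> cantor set" where F: "\<And>n. closed (F n)" "{A. \<not> NP A \<subseteq> BQP A} = (\<Union>n. F n)"
    by (cases rule: fsigma.cases) blast
  have "\<Inter>(generic_sets \<union> range (\<lambda>n. - F n)) \<noteq> {}"
  proof (rule cantor_Baire)
    show "countable (generic_sets \<union> range (\<lambda>n. - F n))"
      by (simp add: countable_generic_sets)
    fix U assume "U \<in> generic_sets \<union> range (\<lambda>n. - F n)"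
    then show "open U \<and> cyl_dense U"
    proof
      assume "U \<in> generic_sets"
      then show ?thesis by (auto simp: generic_sets_def open_failing dense_failing)
    next
      assume "U \<in> range (\<lambda>n. - F n)"
      then obtain n where U: "U = - F n" by blast
      then have "{A. NP A \<subseteq> BQP A} \<subseteq> U" using F(2) by blast
      with assms have "cyl_dense U" unfolding cyl_dense_def by blast
      with F(1) show ?thesis by (simp add: U open_Compl)
    qed
  qed
  then obtain A where A: "A \<in> \<Inter>generic_sets" "\<And>n. A \<notin> F n" by blast
  from generic_separates[OF A(1)] have "A \<in> (\<Union>n. F n)" using F(2) by blast
  with A(2) show False by blast
qed

section \<open>Reversible machines\<close>

definition otape :: "bool list \<Rightarrow> bool list \<Rightarrow> int \<Rightarrow> sym" where
  "otape x w i = Sym (opt_nth x i) None (opt_nth w i) 0"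

lemma otape_step:
  assumes "(q, Sym (opt_nth x (int (length w))) None None 0,
      Sym (opt_nth x (int (length w))) None (Some b) 0, q', MoveR) \<in> R" "q \<noteq> q_final"
  shows "tm_step R (Config (otape x w) (int (length w)) q) (Config (otape x (w @ [b])) (int (length (w @ [b]))) q')"
proof -
  have "tm_step R (Config (otape x w) (int (length w)) q)
     (Config ((otape x w)(int (length w) := Sym (opt_nth x (int (length w))) None (Some b) 0))
       (int (length w) + shift MoveR) q')"
    using assms by (intro tm_step.intros) (auto simp: otape_def)
  also have "(otape x w)(int (length w) := Sym (opt_nth x (int (length w))) None (Some b) 0) = otape x (w @ [b])"
    by (rule ext) (simp add: otape_def opt_nth_snoc)
  finally show ?thesis by (simp add: add.commute)
qed

lemma init_config_otape: "init_config x = Config (otape x []) 0 q_init"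
  by (auto simp: init_config_def init_tape_def otape_def opt_nth_def blank_def fun_eq_iff)

lemma output_is_otape: "output_is (otape x w) w"
  by (auto simp: output_is_def otape_def opt_nth_def)

text \<open>The empty word decodes to 0, so entering the final state at once suffices. The start
  cell is blank for \<open>n = 0\<close>, so the rules cover both a blank and a digit.\<close>

lemma polytime_real_0: "polytime_real 0"
  unfolding polytime_real_def
proof -
  let ?R = "(\<lambda>b. (q_init, Sym b None None 0, Sym b None None 0, q_final, MoveR)) ` UNIV"
  show "\<exists>R p. finite R \<and> deterministic R \<and> (\<forall>n. \<exists>t\<le>poly p n. \<exists>c w. (tm_step R ^^ t) (init_config (replicate n True)) c \<and>
      state_of c = q_final \<and> output_is (tape_of c) w \<and> \<bar>real_of_int (decode_int w) / 2 ^ n - 0\<bar> \<le> 1 / 2 ^ n)"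
  proof (intro exI[of _ ?R] exI[of _ "[:1:]"] conjI allI)
    show "finite ?R" by simp
    show "deterministic ?R" by (auto simp: deterministic_def)
    fix n
    let ?x = "replicate n True"
    have "tm_step ?R (Config (otape ?x []) 0 q_init)
       (Config ((otape ?x [])(0 := otape ?x [] 0)) (0 + shift MoveR) q_final)"
      by (intro tm_step.intros) (auto simp: otape_def)
    then have "(tm_step ?R ^^ 1) (init_config ?x) (Config (otape ?x []) 1 q_final)"
      by (simp add: init_config_otape OO_def)
    moreover have "1 \<le> poly [:1:] n" by simp
    ultimately show "\<exists>t\<le>poly [:1:] n. \<exists>c w. (tm_step ?R ^^ t) (init_config ?x) c \<and> state_of c = q_final \<and>
        output_is (tape_of c) w \<and> \<bar>real_of_int (decode_int w) / 2 ^ n - 0\<bar> \<le> 1 / 2 ^ n"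
      using output_is_otape[of ?x "[]"]
      by (intro exI[of _ 1] conjI exI[of _ "Config (otape ?x []) 1 q_final"] exI[of _ "[]"]) auto
  qed
qed

text \<open>The output is a positive sign and \<open>n\<close> ones, that is
  \<open>2 ^ n - 1\<close>, whose error \<open>1 / 2 ^ n\<close> is just permitted. The sign takes
  one cell, so the last digit falls on the blank after the input. Without an oracle, state 2 is an
  ordinary state.\<close>

definition one_rules :: rules where
  "one_rules =
    {(q_init, Sym (Some True) None None 0, Sym (Some True) None (Some False) 0, 2, MoveR),
     (q_init, Sym None None None 0, Sym None None (Some False) 0, q_final, MoveR),
     (2, Sym (Some True) None None 0, Sym (Some True) None (Some True) 0, 2, MoveR),
     (2, Sym None None None 0, Sym None None (Some True) 0, q_final, MoveR)}"

lemma horner_sum_ones: "horner_sum of_bool 2 (replicate n True) = (2 ^ n - 1 :: int)"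
  by (induction n) auto

lemma polytime_real_1: "polytime_real 1"
  unfolding polytime_real_def
proof (rule exI[of _ one_rules], rule exI[of _ "[:1, 1:]"], intro conjI allI)
  show "finite one_rules" by (simp add: one_rules_def)
  show "deterministic one_rules" by (auto simp: deterministic_def one_rules_def)
  fix n
  let ?x = "replicate n True"
  let ?c = "\<lambda>w q. Config (otape ?x w) (int (length w)) q"
  show "\<exists>t\<le>poly [:1, 1:] n. \<exists>c w. (tm_step one_rules ^^ t) (init_config ?x) c \<and> state_of c = q_final \<and>
      output_is (tape_of c) w \<and> \<bar>real_of_int (decode_int w) / 2 ^ n - 1\<bar> \<le> 1 / 2 ^ n"
  proof (cases n)
    case 0
    have "tm_step one_rules (?c [] q_init) (?c ([] @ [False]) q_final)"
      by (rule otape_step) (auto simp: one_rules_def 0)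
    then have "(tm_step one_rules ^^ 1) (init_config ?x) (?c [False] q_final)"
      by (simp add: init_config_otape OO_def)
    then show ?thesis using output_is_otape[of ?x "[False]"] 0
      by (intro exI[of _ 1] conjI exI[of _ "?c [False] q_final"] exI[of _ "[False]"]) auto
  next
    case (Suc m)
    have run: "(tm_step one_rules ^^ Suc j) (init_config ?x) (?c (False # replicate j True) 2)" if "j < n" for j
      using that
    proof (induction j)
      case 0
      have "tm_step one_rules (?c [] q_init) (?c ([] @ [False]) 2)"
        by (rule otape_step) (auto simp: one_rules_def opt_nth_def Suc)
      then show ?case by (simp add: init_config_otape OO_def)
    next
      case (Suc j)
      have "tm_step one_rules (?c (False # replicate j True) 2) (?c ((False # replicate j True) @ [True]) 2)"
        by (rule otape_step) (use Suc.prems in \<open>auto simp: one_rules_def opt_nth_def\<close>)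
      with Suc show ?case by (auto simp: replicate_append_same)
    qed
    have "tm_step one_rules (?c (False # replicate m True) 2) (?c ((False # replicate m True) @ [True]) q_final)"
      by (rule otape_step) (use Suc in \<open>auto simp: one_rules_def opt_nth_def\<close>)
    then have "(tm_step one_rules ^^ Suc n) (init_config ?x) (?c (False # replicate n True) q_final)"
      using run[of m] Suc by (auto simp: replicate_append_same)
    moreover have "\<bar>real_of_int (decode_int (False # replicate n True)) / 2 ^ n - 1\<bar> \<le> 1 / 2 ^ n"
      by (simp add: horner_sum_ones field_simps)
    ultimately show ?thesis
      using output_is_otape[of ?x "False # replicate n True"]
      by (intro exI[of _ "Suc n"] conjI exI[of _ "?c (False # replicate n True) q_final"]
          exI[of _ "False # replicate n True"]) auto
  qed
qed

section \<open>Injective transition functions give well-formed quantum machines\<close>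

lemma set_qry_simps [simp]:
  "qry (set_qry b s) = Some b" "work (set_qry b s) = work s" "set_qry b (set_qry b' s) = set_qry b s"
  "qry s = Some b \<Longrightarrow> set_qry b s = s"
  by (cases s; simp)+

text \<open>A query changes only the target bit, so the block of query cells and the string asked
  about stay the same, and the second exclusive or cancels the first. This gives injectivity of the
  query step.\<close>

lemma query_tape_involution: "query_tape A (query_tape A T) = T"
proof (cases "query_string T = []")
  case True
  then show ?thesis by (simp add: query_tape_def)
next
  case False
  then obtain a b where ab: "a \<le> b" "query_cells T = {a..b}"
    by (auto simp: query_string_def split: if_splits)
  have Min: "Min {a..b} = a" and Max: "Max {a..b} = b"
    using ab(1) by (auto intro: Min_eqI Max_eqI)
  have str: "query_string U = map (\<lambda>i. the (qry (U i))) [a..b - 1] @ [the (qry (U b))]"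
    if "query_cells U = {a..b}" for U
  proof -
    have "query_string U = map (\<lambda>i. the (qry (U i))) [a..b]"
      using that ab(1) unfolding query_string_def by (auto simp: Min Max)
    then show ?thesis using upto_rec2[OF ab(1)] by simp
  qed
  have tape: "query_tape A U = U(b := set_qry (the (qry (U b)) \<noteq>
      oracle_mem A (map (\<lambda>i. the (qry (U i))) [a..b - 1])) (U b))"
    if "query_cells U = {a..b}" for U
    unfolding query_tape_def str[OF that] that Max by (simp add: Let_def)
  let ?m = "oracle_mem A (map (\<lambda>i. the (qry (T i))) [a..b - 1])"
  define U where "U = T(b := set_qry (the (qry (T b)) \<noteq> ?m) (T b))"
  have cells: "query_cells U = {a..b}"
    using ab by (auto simp: query_cells_def U_def)
  have "map (\<lambda>i. the (qry (U i))) [a..b - 1] = map (\<lambda>i. the (qry (T i))) [a..b - 1]"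
    by (auto simp: U_def)
  then have "query_tape A U = U(b := set_qry (the (qry (U b)) \<noteq> ?m) (U b))"
    using tape[OF cells] by (simp only:)
  also have "U b = set_qry (the (qry (T b)) \<noteq> ?m) (T b)" by (simp add: U_def)
  also have "(the (qry (set_qry (the (qry (T b)) \<noteq> ?m) (T b))) \<noteq> ?m) = the (qry (T b))" by auto
  also have "set_qry (the (qry (T b))) (set_qry (the (qry (T b)) \<noteq> ?m) (T b)) = T b"
  proof -
    have "b \<in> query_cells T" using ab by simp
    then show ?thesis by (auto simp: query_cells_def)
  qed
  also have "U(b := T b) = T" by (simp add: U_def)
  finally have "query_tape A U = T" .
  then show ?thesis using tape[OF ab(2)] by (simp add: U_def)
qed

text \<open>The direction depends only on the state entered, so that the previous head position can
  be recovered from a configuration. The query state is left out of the domain and the postquery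
  state out of the range because that transition belongs to the oracle. The last two assumptions
  provide the normal form.\<close>

locale reversible =
  fixes g :: "nat \<times> sym \<Rightarrow> nat \<times> sym" and dr :: "nat \<Rightarrow> dir" and ns nw :: nat
  assumes ns: "ns \<ge> 4" and nw: "nw \<ge> 1"
    and inj_g: "inj_on g (({..<ns} - {q_query}) \<times> {s. work s < nw})"
    and range_g: "g ` (({..<ns} - {q_query}) \<times> {s. work s < nw}) \<subseteq> ({..<ns} - {q_post}) \<times> {s. work s < nw}"
    and g_final: "work s < nw \<Longrightarrow> g (q_final, s) = (q_init, s)" and dr_init: "dr q_init = MoveR"
begin

definition machine :: qtm where
  "machine = \<lparr>n_states = ns, n_work = nw, delta = (\<lambda>q s s' q' d.
     if q \<noteq> q_query \<and> q < ns \<and> work s < nw \<and> g (q, s) = (q', s') \<and> d = dr q' then 1 else 0)\<rparr>"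

definition nxt :: "cantor \<Rightarrow> config \<Rightarrow> config" where
  "nxt A c = (let T = tape_of c; h = head_of c; q = state_of c in
     if q = q_query then Config (query_tape A T) h q_post
     else Config (T(h := snd (g (q, T h)))) (h + shift (dr (fst (g (q, T h))))) (fst (g (q, T h))))"

lemma alphabet_machine: "alphabet machine = {s. work s < nw}"
  by (simp add: alphabet_def machine_def)

lemma g_range:
  assumes "q < ns" "q \<noteq> q_query" "work s < nw" "g (q, s) = (q', s')"
  shows "q' < ns" "q' \<noteq> q_post" "work s' < nw"
proof -
  have "g (q, s) \<in> ({..<ns} - {q_post}) \<times> {s. work s < nw}" using range_g assms by blast
  then show "q' < ns" "q' \<noteq> q_post" "work s' < nw" using assms by auto
qed

lemma is_qtm_machine: "is_qtm machine"
proof -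
  have "polytime_complex 0" "polytime_complex 1"
    by (simp_all add: polytime_complex_def polytime_real_0 polytime_real_1)
  moreover have "q < ns \<and> work s < nw \<and> work s' < nw \<and> q' < ns" if "delta machine q s s' q' d \<noteq> 0" for q s s' q' d
    using that g_range[of q s q' s'] by (auto simp: machine_def split: if_splits)
  moreover have "n_states machine = ns" "n_work machine = nw" by (simp_all add: machine_def)
  moreover have "delta machine q s s' q' d \<in> {0, 1}" for q s s' q' d by (simp add: machine_def)
  ultimately show ?thesis
    using ns nw unfolding is_qtm_def alphabet_machine by (metis insertE mem_Collect_eq singletonD)
qed

lemma normal_form_machine: "normal_form machine"
proof -
  have "1 < ns" using ns by simp
  then show ?thesis
    unfolding normal_form_def alphabet_machine by (auto simp: machine_def g_final[simplified] dr_init)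
qed

lemma configs_machine_cell: "c \<in> configs machine \<Longrightarrow> work (tape_of c i) < nw"
  unfolding configs_def alphabet_machine by auto

lemma configs_machine_state: "c \<in> configs machine \<Longrightarrow> state_of c < ns"
  unfolding configs_def by (simp add: machine_def)

lemma step_amp_machine:
  assumes "c \<in> configs machine"
  shows "step_amp machine A c c' = (if c' = nxt A c then 1 else 0)"
proof (cases "state_of c = q_query")
  case True
  then show ?thesis by (simp add: step_amp_def nxt_def Let_def)
next
  case False
  obtain T h q where c: "c = Config T h q" by (cases c)
  obtain q'' s'' where g: "g (q, T h) = (q'', s'')" by fastforce
  have q: "q \<noteq> q_query" "q < ns" "work (T h) < nw"
    using False configs_machine_cell[OF assms, of h] configs_machine_state[OF assms] by (simp_all add: c)
  have nxt: "nxt A c = Config (T(h := s'')) (h + shift (dr q'')) q''"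
    using q by (simp add: nxt_def c g Let_def)
  show ?thesis
  proof (cases "\<exists>s. tape_of c' = T(h := s)")
    case True
    then obtain s h' q' where c': "c' = Config (T(h := s)) h' q'" by (cases c') auto
    have "T(h := s) = T(h := s'') \<longleftrightarrow> s = s''" by (metis fun_upd_same)
    then show ?thesis
      unfolding nxt unfolding c c' step_amp_move[OF q(1)]
      using q g by (cases "dr q''") (auto simp: machine_def)
  next
    case F: False
    then have "step_amp machine A c c' = 0" using q by (auto simp: step_amp_def c)
    moreover have "c' \<noteq> nxt A c" using F unfolding nxt by auto
    ultimately show ?thesis by simp
  qed
qed

lemma nxt_configs:
  assumes "c \<in> configs machine"
  shows "nxt A c \<in> configs machine"
proof -
  have "step_amp machine A c (nxt A c) \<noteq> 0" by (simp add: step_amp_machine assms)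
  then show ?thesis using step_amp_support[OF is_qtm_machine assms] by blast
qed

text \<open>The postquery state tells whether the last step was a query, which is undone by the
  involution. Otherwise the state entered gives the direction, hence the old head position; the
  symbol there and injectivity of \<open>g\<close> give back the old state and symbol.\<close>

lemma inj_nxt: "inj_on (nxt A) (configs machine)"
proof (rule inj_onI)
  fix c1 c2
  assume c: "c1 \<in> configs machine" "c2 \<in> configs machine" and eq: "nxt A c1 = nxt A c2"
  obtain T1 h1 q1 where c1: "c1 = Config T1 h1 q1" by (cases c1)
  obtain T2 h2 q2 where c2: "c2 = Config T2 h2 q2" by (cases c2)
  obtain p1 s1 where g1: "g (q1, T1 h1) = (p1, s1)" by fastforce
  obtain p2 s2 where g2: "g (q2, T2 h2) = (p2, s2)" by fastforce
  have ok: "q1 < ns" "q2 < ns" "work (T1 h1) < nw" "work (T2 h2) < nw"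
    using configs_machine_cell[OF c(1), of h1] configs_machine_cell[OF c(2), of h2]
      configs_machine_state[OF c(1)] configs_machine_state[OF c(2)] by (simp_all add: c1 c2)
  have n1: "nxt A c1 = (if q1 = q_query then Config (query_tape A T1) h1 q_post
      else Config (T1(h1 := s1)) (h1 + shift (dr p1)) p1)"
    by (simp add: nxt_def c1 g1 Let_def)
  have n2: "nxt A c2 = (if q2 = q_query then Config (query_tape A T2) h2 q_post
      else Config (T2(h2 := s2)) (h2 + shift (dr p2)) p2)"
    by (simp add: nxt_def c2 g2 Let_def)
  have post: "q1 \<noteq> q_query \<Longrightarrow> p1 \<noteq> q_post" "q2 \<noteq> q_query \<Longrightarrow> p2 \<noteq> q_post"
    using g_range(2)[OF ok(1) _ ok(3) g1] g_range(2)[OF ok(2) _ ok(4) g2] by auto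
  show "c1 = c2"
  proof (cases "q1 = q_query")
    case True
    with eq n1 n2 post(2) have "q2 = q_query" by (auto split: if_splits)
    with True eq n1 n2 have "query_tape A T1 = query_tape A T2" "h1 = h2" by auto
    then have "T1 = T2" by (metis query_tape_involution)
    with True \<open>q2 = q_query\<close> \<open>h1 = h2\<close> show ?thesis by (simp add: c1 c2)
  next
    case False
    with eq n1 n2 post(1) have q2: "q2 \<noteq> q_query" by (auto split: if_splits)
    with False eq n1 n2 have "T1(h1 := s1) = T2(h2 := s2)" "h1 + shift (dr p1) = h2 + shift (dr p2)" "p1 = p2"
      by auto
    then have h: "h1 = h2" and T: "T1(h1 := s1) = T2(h1 := s2)" and p: "p1 = p2" by auto
    have s: "s1 = s2" using T by (metis fun_upd_same)
    have "g (q1, T1 h1) = g (q2, T2 h2)" using g1 g2 p s by simp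
    then have qT: "(q1, T1 h1) = (q2, T2 h2)"
      by (rule inj_onD[OF inj_g]) (use ok False q2 in auto)
    have "T1 i = T2 i" for i
      using fun_cong[OF T, of i] qT h by (cases "i = h1") auto
    with qT h show ?thesis by (auto simp: c1 c2)
  qed
qed

text \<open>The evolution only moves amplitudes along the injection \<open>nxt A\<close>, so no two
  of them interfere.\<close>

lemma well_formed_machine: "well_formed machine"
  unfolding well_formed_def
proof (intro allI ballI)
  fix A \<psi> assume "\<psi> \<in> superpositions machine"
  then have fin: "finite (supp \<psi>)" and sub: "supp \<psi> \<subseteq> configs machine"
    by (auto simp: superpositions_def)
  have inj: "inj_on (nxt A) (supp \<psi>)" using inj_nxt sub by (rule inj_on_subset)
  have ev: "evolve machine A \<psi> c' = (\<Sum>c\<in>supp \<psi>. if c' = nxt A c then \<psi> c else 0)" for c'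
    unfolding evolve_def using sub by (intro sum.cong) (auto simp: step_amp_machine subset_iff)
  have val: "evolve machine A \<psi> (nxt A c) = \<psi> c" if "c \<in> supp \<psi>" for c
  proof -
    have "evolve machine A \<psi> (nxt A c) = (\<Sum>c'\<in>supp \<psi>. if c' = c then \<psi> c' else 0)"
      unfolding ev using inj that by (intro sum.cong) (auto simp: inj_on_def)
    then show ?thesis using fin that by simp
  qed
  have "supp (evolve machine A \<psi>) \<subseteq> nxt A ` supp \<psi>"
  proof
    fix c' assume "c' \<in> supp (evolve machine A \<psi>)"
    then have "(\<Sum>c\<in>supp \<psi>. if c' = nxt A c then \<psi> c else 0) \<noteq> 0" by (simp add: supp_def ev)
    then obtain c where "c \<in> supp \<psi>" "(if c' = nxt A c then \<psi> c else 0) \<noteq> 0"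
      by (rule sum.not_neutral_contains_not_neutral)
    then show "c' \<in> nxt A ` supp \<psi>" by (auto split: if_splits)
  qed
  then have "sq_norm (evolve machine A \<psi>) = (\<Sum>c'\<in>nxt A ` supp \<psi>. (cmod (evolve machine A \<psi> c'))\<^sup>2)"
    using fin by (intro sq_norm_superset) auto
  also have "\<dots> = (\<Sum>c\<in>supp \<psi>. (cmod (evolve machine A \<psi> (nxt A c)))\<^sup>2)"
    using inj by (simp add: sum.reindex)
  also have "\<dots> = sq_norm \<psi>"
    unfolding sq_norm_def by (intro sum.cong) (auto simp: val)
  finally show "sq_norm (evolve machine A \<psi>) = sq_norm \<psi>" .
qed

lemma nxt_power_configs: "(nxt A ^^ t) (init_config x) \<in> configs machine"
  by (induction t) (auto intro: nxt_configs init_config_configs is_qtm_machine)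

lemma supp_indicator: "supp (\<lambda>c. if c = c0 then 1 else 0) = {c0}"
  by (auto simp: supp_def)

lemma run_machine:
  "run machine A x t = (\<lambda>c. if c = (nxt A ^^ t) (init_config x) then 1 else 0)"
proof (induction t)
  case 0
  then show ?case by (simp add: run_0)
next
  case (Suc t)
  show ?case
    unfolding run_Suc Suc evolve_def supp_indicator
    by (rule ext) (simp add: step_amp_machine nxt_power_configs)
qed

lemma decides_machine:
  assumes "(nxt A ^^ T) (init_config x) = c" "\<And>t. t < T \<Longrightarrow> state_of ((nxt A ^^ t) (init_config x)) \<noteq> q_final"
    and "state_of c = q_final" "head_of c = 0" "outp (tape_of c 0) = Some b" "T \<le> n"
  shows "decides machine A n x b"
proof -
  have "accept_prob (run machine A x T) = (if b then 1 else 0)"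
  proof -
    have "{d \<in> {c}. outp (tape_of d 0) = Some True} = (if b then {c} else {})"
      using assms(5) by auto
    then show ?thesis by (simp add: accept_prob_def run_machine supp_indicator assms(1))
  qed
  then show ?thesis
    unfolding decides_def halts_at_def using assms(2-4,6)
    by (intro exI[of _ T]) (auto simp: run_machine supp_indicator assms(1))
qed

end

text \<open>Such a relation is itself a bijection from its domain to its range, so the parts of
  \<open>S\<close> and \<open>T\<close> outside them are equinumerous and any bijection between
  these completes it.\<close>

lemma extend_to_bij:
  assumes fin: "finite S" "finite T" and card: "card S = card T"
    and r: "r \<subseteq> S \<times> T" and det: "\<And>a b b'. (a, b) \<in> r \<Longrightarrow> (a, b') \<in> r \<Longrightarrow> b = b'"
    and inj: "\<And>a a' b. (a, b) \<in> r \<Longrightarrow> (a', b) \<in> r \<Longrightarrow> a = a'"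
  shows "\<exists>g. bij_betw g S T \<and> (\<forall>(a, b) \<in> r. g a = b)"
proof -
  define f where "f a = (THE b. (a, b) \<in> r)" for a
  have f: "f a = b" if "(a, b) \<in> r" for a b
    using that det unfolding f_def by blast
  have bij: "bij_betw f (Domain r) (Range r)"
  proof (rule bij_betw_imageI)
    show "inj_on f (Domain r)" using f inj by (metis Domain.cases inj_onI)
    show "f ` Domain r = Range r" using f by (force simp: image_iff Domain_iff Range_iff)
  qed
  have sub: "Domain r \<subseteq> S" "Range r \<subseteq> T" using r by auto
  have "card (Domain r) = card (Range r)" using bij by (rule bij_betw_same_card)
  then have "card (S - Domain r) = card (T - Range r)"
    using sub fin card by (simp add: card_Diff_subset finite_subset)
  then obtain h where h: "bij_betw h (S - Domain r) (T - Range r)"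
    using finite_same_card_bij[OF finite_Diff[OF fin(1)] finite_Diff[OF fin(2)]] by blast
  define g where "g a = (if a \<in> Domain r then f a else h a)" for a
  have "bij_betw g (Domain r) (Range r)"
    using bij by (rule bij_betw_cong[THEN iffD1, rotated]) (simp add: g_def)
  moreover have "bij_betw g (S - Domain r) (T - Range r)"
    using h by (rule bij_betw_cong[THEN iffD1, rotated]) (simp add: g_def)
  ultimately have "bij_betw g (Domain r \<union> (S - Domain r)) (Range r \<union> (T - Range r))"
    by (rule bij_betw_combine) auto
  moreover have "Domain r \<union> (S - Domain r) = S" "Range r \<union> (T - Range r) = T" using sub by auto
  moreover have "\<forall>(a, b) \<in> r. g a = b" using f by (auto simp: g_def)
  ultimately show ?thesis by metis
qed

section \<open>A reversible machine that pads its query until the oracle tells it to stop\<close>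

text \<open>Only the rules used on actual runs, to be extended to a bijection below. The work symbol 1 marks
  the start cell; the work symbol 2, at the end of the prefix, makes the first entry into state 7
  distinguishable from the later ones, and the erasure in \<open>answer\<close> does the same for the states that
  return with the answer 1 (state 11) or 0 (state 4).\<close>

inductive rule :: "nat \<Rightarrow> nat \<times> sym \<Rightarrow> nat \<times> sym \<Rightarrow> bool" for e where
  final: "work s < 3 \<Longrightarrow> rule e (1, s) (0, s)"
| mark: "rule e (0, Sym i None None 0) (5, Sym i None None 1)"
| turn: "rule e (5, Sym None None None 0) (6, Sym None None None 0)"
| copy: "k < 2 \<Longrightarrow> rule e (6, Sym (Some b) None None k) (6, Sym (Some b) (Some b) None k)"
| delim: "k < 2 \<Longrightarrow> rule e (6, Sym None None None k) (12, Sym None (Some True) None k)"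
| zero: "j < e \<Longrightarrow> rule e (12 + j, Sym None None None 0) (13 + j, Sym None (Some False) None 0)"
| one: "rule e (12 + e, Sym None None None 0) (13 + e, Sym None (Some True) None 0)"
| last: "rule e (13 + e, Sym None None None 0) (7, Sym None (Some False) None 2)"
| ask: "rule e (7, Sym None None None 0) (2, Sym None (Some False) None 0)"
| more: "k = 0 \<or> k = 2 \<Longrightarrow> rule e (3, Sym None (Some False) None k) (9, Sym None (Some False) None k)"
| stop: "rule e (3, Sym None (Some True) None 0) (10, Sym None (Some True) None 0)"
| again: "rule e (9, Sym None (Some b) None 0) (7, Sym None (Some b) None 0)"
| answer: "q = (if a then 11 else 4) \<Longrightarrow> rule e (10, Sym None (Some a) None 0) (q, Sym None None None 0)"
| return: "q = 4 \<or> q = 11 \<Longrightarrow> k = 0 \<or> k = 2 \<Longrightarrow> rule e (q, Sym i (Some b) None k) (q, Sym i (Some b) None k)"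
| emit: "q = (if a then 11 else 4) \<Longrightarrow> rule e (q, Sym i (Some b) None 1) (8, Sym i (Some b) (Some a) 1)"
| halt: "rule e (8, Sym None None None 0) (1, Sym None None None 0)"

text \<open>Entering the query state 2 moves left, so that after the query the machine reads the bit
  before the answer. States 4 and 11 walk back to the start cell. States 5 and 8 make an excursion
  to cell -1: the step back to the right begins the copying at cell 0 and, at the end, halts the
  machine there.\<close>

definition heading :: "nat \<Rightarrow> dir" where
  "heading q = (if q \<in> {2, 4, 5, 8, 11} then MoveL else MoveR)"

lemma rule_det:
  assumes "rule e a b" "rule e a b'"
  shows "b = b'"
  using assms(1) by cases (use assms(2) in \<open>cases; auto split: if_splits\<close>)+

lemma rule_inj:
  assumes "rule e a b" "rule e a' b"
  shows "a = a'"
  using assms(1) by cases (use assms(2) in \<open>cases; auto split: if_splits\<close>)+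

lemma rule_range:
  assumes "rule e (q, s) (q', s')"
  shows "q < 14 + e \<and> q \<noteq> 2 \<and> work s < 3 \<and> q' < 14 + e \<and> q' \<noteq> 3 \<and> work s' < 3"
  using assms by cases (auto split: if_splits)

text \<open>A query passes from state 2 to state 3 outside the transition function, so these two states are
  missing from its domain and range, respectively.\<close>

lemma ex_transition:
  "\<exists>g. bij_betw g (({..<14 + e} - {2}) \<times> {s. work s < 3}) (({..<14 + e} - {3}) \<times> {s. work s < 3}) \<and>
     (\<forall>a b. rule e a b \<longrightarrow> g a = b)"
proof -
  have fin: "finite {s. work s < 3}"
    using finite_alphabet[of "\<lparr>n_states = 0, n_work = 3, delta = undefined\<rparr>"] by (simp add: alphabet_def)
  have "\<exists>g. bij_betw g (({..<14 + e} - {2}) \<times> {s. work s < 3}) (({..<14 + e} - {3}) \<times> {s. work s < 3}) \<and>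
     (\<forall>(a, b) \<in> {(a, b). rule e a b}. g a = b)"
  proof (rule extend_to_bij)
    show "card (({..<14 + e} - {2}) \<times> {s. work s < 3}) = card (({..<14 + e} - {3}) \<times> {s. work s < 3})"
      by (simp add: card_cartesian_product)
    show "{(a, b). rule e a b} \<subseteq> (({..<14 + e} - {2}) \<times> {s. work s < 3}) \<times> (({..<14 + e} - {3}) \<times> {s. work s < 3})"
      using rule_range by fastforce
  qed (use fin in \<open>auto dest: rule_det rule_inj\<close>)
  then show ?thesis by auto
qed

text \<open>The block of \<open>e\<close> zeros identifies the language; counting zeros from the right makes the
  string decodable.\<close>

definition padded :: "bool list \<Rightarrow> nat \<Rightarrow> nat \<Rightarrow> bool list" where
  "padded x e k = x @ True # replicate e False @ True # replicate (Suc k) False"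

lemma length_padded: "length (padded x e k) = length x + e + k + 3"
  by (simp add: padded_def)

lemma padded_Suc: "padded x e (Suc k) = padded x e k @ [False]"
  by (simp add: padded_def replicate_append_same)

text \<open>The position \<open>length x + e + 2\<close> is the last cell of
  \<open>padded x e 0\<close>; it receives the work symbol 2 only when the query track
  \<open>z\<close> has reached it.\<close>

definition ptape :: "bool list \<Rightarrow> nat \<Rightarrow> bool list \<Rightarrow> int \<Rightarrow> sym" where
  "ptape x e z = tape (\<lambda>i. if i = 0 then 1 else
     if i = int (length x + e + 2) \<and> i < int (length z) then 2 else 0) x z"

lemma ptape_end: "ptape x e z (int (length z)) =
    Sym (opt_nth x (int (length z))) None None (if z = [] then 1 else 0)"
  by (auto simp: ptape_def tape_def)

lemma ptape_snoc:
  "(ptape x e z)(int (length z) := Sym (opt_nth x (int (length z))) (Some b) None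
      (if z = [] then 1 else if length z = length x + e + 2 then 2 else 0)) = ptape x e (z @ [b])"
  by (rule ext) (auto simp: ptape_def tape_def opt_nth_snoc)

lemma ptape_last:
  assumes "length z > length x + e + 2"
  shows "ptape x e (z @ [b]) (int (length z)) = Sym None (Some b) None 0"
  using assms by (auto simp: ptape_def tape_def opt_nth_snoc)

lemma ptape_erase:
  assumes "length z > length x + e + 2"
  shows "(ptape x e (z @ [b]))(int (length z) := Sym None None None 0) = ptape x e z"
  using assms by (intro ext) (auto simp: ptape_def tape_def opt_nth_snoc)

locale padding_machine =
  fixes e :: nat and g :: "nat \<times> sym \<Rightarrow> nat \<times> sym"
  assumes bij_g: "bij_betw g (({..<14 + e} - {2}) \<times> {s. work s < 3}) (({..<14 + e} - {3}) \<times> {s. work s < 3})"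
    and g_rule: "rule e a b \<Longrightarrow> g a = b"
begin

sublocale reversible g heading "14 + e" 3
proof
  show "inj_on g (({..<14 + e} - {q_query}) \<times> {s. work s < 3})"
    "g ` (({..<14 + e} - {q_query}) \<times> {s. work s < 3}) \<subseteq> ({..<14 + e} - {q_post}) \<times> {s. work s < 3}"
    using bij_g by (auto simp: bij_betw_def)
  show "g (q_final, s) = (q_init, s)" if "work s < 3" for s
    by (rule g_rule) (rule rule.final[OF that])
qed (auto simp: heading_def)

text \<open>The final state is excluded only before the endpoint. This makes the relation transitive
  with adding step counts, and it is what \<open>halts_at\<close> asks of the halting time.\<close>

definition leads :: "cantor \<Rightarrow> nat \<Rightarrow> config \<Rightarrow> config \<Rightarrow> bool" where
  "leads A t c d \<longleftrightarrow> (nxt A ^^ t) c = d \<and> (\<forall>i<t. state_of ((nxt A ^^ i) c) \<noteq> q_final)"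

lemma leads_refl: "leads A 0 c c"
  by (simp add: leads_def)

lemma leads_eq: "leads A s c d \<Longrightarrow> s = t \<Longrightarrow> leads A t c d"
  by simp

lemma leads_trans [trans]:
  assumes "leads A s c d" "leads A t d d'"
  shows "leads A (s + t) c d'"
proof -
  have pow: "(nxt A ^^ (s + i)) c = (nxt A ^^ i) d" for i
    using assms(1) by (simp add: leads_def funpow_add add.commute[of s])
  have "state_of ((nxt A ^^ i) c) \<noteq> q_final" if "i < s + t" for i
  proof (cases "i < s")
    case True
    then show ?thesis using assms(1) by (simp add: leads_def)
  next
    case False
    then have "(nxt A ^^ i) c = (nxt A ^^ (i - s)) d" using pow[of "i - s"] by simp
    then show ?thesis using assms(2) False that by (simp add: leads_def)
  qed
  then show ?thesis using assms(2) pow[of t] by (simp add: leads_def)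
qed

lemma leads_rule:
  assumes "rule e (q, T h) (q', s')" "q \<noteq> q_final" "T' = T(h := s')" "h' = h + shift (heading q')"
  shows "leads A 1 (Config T h q) (Config T' h' q')"
proof -
  have "q \<noteq> q_query" using rule_range[OF assms(1)] by simp
  then show ?thesis using assms(2-4) g_rule[OF assms(1)] by (simp add: leads_def nxt_def Let_def)
qed

lemma leads_stay:
  assumes "rule e (q, T h) (q', T h)" "q \<noteq> q_final" "h' = h + shift (heading q')"
  shows "leads A 1 (Config T h q) (Config T h' q')"
  using assms by (intro leads_rule) auto

lemma leads_query: "leads A 1 (Config T h q_query) (Config (query_tape A T) h q_post)"
  by (simp add: leads_def nxt_def Let_def)

lemma leads_append:
  assumes "rule e (q, Sym (opt_nth x (int (length z))) None None (if z = [] then 1 else 0))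
      (q', Sym (opt_nth x (int (length z))) (Some b) None
        (if z = [] then 1 else if length z = length x + e + 2 then 2 else 0))" "q \<noteq> q_final"
    "h = int (length z)" "h' = h + shift (heading q')" "z' = z @ [b]"
  shows "leads A 1 (Config (ptape x e z) h q) (Config (ptape x e z') h' q')"
  unfolding assms(3,5)
proof (rule leads_rule[OF _ assms(2) ptape_snoc[symmetric]])
  show "rule e (q, ptape x e z (int (length z))) (q', Sym (opt_nth x (int (length z))) (Some b) None
      (if z = [] then 1 else if length z = length x + e + 2 then 2 else 0))"
    unfolding ptape_end by (rule assms(1))
  show "h' = int (length z) + shift (heading q')" using assms(3,4) by simp
qed

lemma leads_start: "leads A 2 (init_config x) (Config (ptape x e []) 0 6)"
proof -
  have "leads A 1 (init_config x) (Config (ptape x e []) (-1) 5)"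
    unfolding init_config_def
  proof (rule leads_rule)
    show "rule e (0, init_tape x 0) (5, Sym (opt_nth x 0) None None 1)"
      using mark by (simp add: init_tape_eq tape_def)
    show "ptape x e [] = (init_tape x)(0 := Sym (opt_nth x 0) None None 1)"
      by (rule ext) (auto simp: init_tape_eq ptape_def tape_def)
  qed (auto simp: heading_def)
  also have "leads A 1 (Config (ptape x e []) (-1) 5) (Config (ptape x e []) 0 6)"
    by (rule leads_stay) (use turn in \<open>auto simp: ptape_def tape_def heading_def\<close>)
  finally show ?thesis by (rule leads_eq) simp
qed

lemma leads_copy:
  "j \<le> length x \<Longrightarrow> leads A j (Config (ptape x e []) 0 6) (Config (ptape x e (take j x)) (int j) 6)"
proof (induction j)
  case 0
  then show ?case by (simp add: leads_refl)
next
  case (Suc j)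
  then have "leads A j (Config (ptape x e []) 0 6) (Config (ptape x e (take j x)) (int j) 6)" by simp
  also have "leads A 1 (Config (ptape x e (take j x)) (int j) 6) (Config (ptape x e (take (Suc j) x)) (int (Suc j)) 6)"
    by (rule leads_append[where b = "x ! j"])
      (use Suc.prems in \<open>auto simp: take_Suc_conv_app_nth heading_def intro!: rule.copy\<close>)
  finally show ?case by simp
qed

lemma leads_zeros:
  "j \<le> e \<Longrightarrow> leads A j (Config (ptape x e (x @ [True])) (int (length x) + 1) 12)
     (Config (ptape x e (x @ True # replicate j False)) (int (length x + j) + 1) (12 + j))"
proof (induction j)
  case 0
  then show ?case by (simp add: leads_refl)
next
  case (Suc j)
  then have "leads A j (Config (ptape x e (x @ [True])) (int (length x) + 1) 12)
     (Config (ptape x e (x @ True # replicate j False)) (int (length x + j) + 1) (12 + j))" by simp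
  also have "leads A 1 (Config (ptape x e (x @ True # replicate j False)) (int (length x + j) + 1) (12 + j))
     (Config (ptape x e (x @ True # replicate (Suc j) False)) (int (length x + Suc j) + 1) (12 + Suc j))"
    by (rule leads_append[where b = False])
      (use Suc.prems rule.zero[of j e] in \<open>auto simp: heading_def opt_nth_def replicate_append_same\<close>)
  finally show ?case by simp
qed

lemma leads_padded_0:
  "leads A (length x + e + 5) (init_config x) (Config (ptape x e (padded x e 0)) (int (length (padded x e 0))) 7)"
proof -
  let ?z = "x @ True # replicate e False"
  have "leads A 2 (init_config x) (Config (ptape x e []) 0 6)" by (rule leads_start)
  also have "leads A (length x) (Config (ptape x e []) 0 6) (Config (ptape x e x) (int (length x)) 6)"
    using leads_copy[of "length x" x] by simp
  also have "leads A 1 (Config (ptape x e x) (int (length x)) 6) (Config (ptape x e (x @ [True])) (int (length x) + 1) 12)"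
    by (rule leads_append[where b = True]) (auto simp: heading_def intro!: rule.delim)
  also have "leads A e (Config (ptape x e (x @ [True])) (int (length x) + 1) 12)
     (Config (ptape x e ?z) (int (length x + e) + 1) (12 + e))"
    by (rule leads_zeros) simp
  also have "leads A 1 (Config (ptape x e ?z) (int (length x + e) + 1) (12 + e))
     (Config (ptape x e (?z @ [True])) (int (length x + e) + 2) (13 + e))"
    by (rule leads_append[where b = True]) (use rule.one in \<open>auto simp: heading_def opt_nth_def\<close>)
  also have "leads A 1 (Config (ptape x e (?z @ [True])) (int (length x + e) + 2) (13 + e))
     (Config (ptape x e (padded x e 0)) (int (length (padded x e 0))) 7)"
    by (rule leads_append[where b = False]) (use rule.last in \<open>auto simp: heading_def opt_nth_def padded_def\<close>)
  finally show ?thesis by (rule leads_eq) simp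
qed

text \<open>After the query the head stands on the last bit \<open>b\<close> of the string just
  asked about, not on its answer: \<open>b\<close> is True exactly when the previous answer was the
  stop signal. The last hypothesis keeps that bit off the cell with work symbol 2, since
  \<open>stop\<close> expects 0.\<close>

lemma leads_ask:
  assumes "length z \<ge> length x + e + 3" "z = y @ [b]" "b \<Longrightarrow> length z > length x + e + 3"
  shows "leads A 3 (Config (ptape x e z) (int (length z)) 7)
    (Config (ptape x e (z @ [oracle_mem A z])) (int (length z)) (if b then 10 else 9))"
proof -
  have "leads A 1 (Config (ptape x e z) (int (length z)) 7) (Config (ptape x e (z @ [False])) (int (length z) - 1) 2)"
    by (rule leads_append[where b = False]) (use assms rule.ask in \<open>auto simp: heading_def opt_nth_def\<close>)
  also have "leads A 1 \<dots> (Config (query_tape A (ptape x e (z @ [False]))) (int (length z) - 1) 3)"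
    by (rule leads_query)
  also have "query_tape A (ptape x e (z @ [False])) = ptape x e (z @ [oracle_mem A z])"
    unfolding ptape_def query_tape_tape length_append_singleton by simp
  also have "leads A 1 (Config (ptape x e (z @ [oracle_mem A z])) (int (length z) - 1) 3)
    (Config (ptape x e (z @ [oracle_mem A z])) (int (length z)) (if b then 10 else 9))"
  proof (rule leads_stay)
    have len: "int (length z) - 1 = int (length y)" using assms(2) by simp
    have "ptape x e (z @ [oracle_mem A z]) (int (length z) - 1) =
        Sym None (Some b) None (if length y = length x + e + 2 then 2 else 0)"
      unfolding len using assms(1,2) by (auto simp: ptape_def tape_def nth_append)
    then show "rule e (3, ptape x e (z @ [oracle_mem A z]) (int (length z) - 1))
      (if b then 10 else 9, ptape x e (z @ [oracle_mem A z]) (int (length z) - 1))"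
      using assms(2,3) rule.more rule.stop by (cases b) auto
  qed (auto simp: heading_def)
  finally show ?thesis by (rule leads_eq) simp
qed

text \<open>Three steps ask and one passes over the answer, which thereby becomes part of the next
  query. A negative answer gives \<open>padded x e (Suc k)\<close>, a positive one the question
  \<open>padded x e k @ [True]\<close>.\<close>

lemma leads_round:
  "leads A 4 (Config (ptape x e (padded x e k)) (int (length (padded x e k))) 7)
    (Config (ptape x e (padded x e k @ [oracle_mem A (padded x e k)])) (int (length (padded x e k)) + 1) 7)"
proof -
  let ?z = "padded x e k"
  obtain y where y: "?z = y @ [False]" by (cases k) (auto simp: padded_def replicate_append_same[symmetric])
  have "leads A 3 (Config (ptape x e ?z) (int (length ?z)) 7)
    (Config (ptape x e (?z @ [oracle_mem A ?z])) (int (length ?z)) 9)"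
    using leads_ask[OF _ y, of x A] by (simp add: length_padded)
  also have "leads A 1 (Config (ptape x e (?z @ [oracle_mem A ?z])) (int (length ?z)) 9)
    (Config (ptape x e (?z @ [oracle_mem A ?z])) (int (length ?z) + 1) 7)"
  proof (rule leads_stay)
    have "ptape x e (?z @ [oracle_mem A ?z]) (int (length ?z)) = Sym None (Some (oracle_mem A ?z)) None 0"
      by (rule ptape_last) (simp add: length_padded)
    then show "rule e (9, ptape x e (?z @ [oracle_mem A ?z]) (int (length ?z)))
       (7, ptape x e (?z @ [oracle_mem A ?z]) (int (length ?z)))"
      using rule.again by simp
  qed (auto simp: heading_def)
  finally show ?thesis by simp
qed

lemma leads_loop:
  "(\<And>j. j < k \<Longrightarrow> \<not> oracle_mem A (padded x e j)) \<Longrightarrow>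
   leads A (4 * k) (Config (ptape x e (padded x e 0)) (int (length (padded x e 0))) 7)
    (Config (ptape x e (padded x e k)) (int (length (padded x e k))) 7)"
proof (induction k)
  case 0
  then show ?case by (simp add: leads_refl)
next
  case (Suc k)
  then have "leads A (4 * k) (Config (ptape x e (padded x e 0)) (int (length (padded x e 0))) 7)
    (Config (ptape x e (padded x e k)) (int (length (padded x e k))) 7)" by simp
  also have "leads A 4 \<dots> (Config (ptape x e (padded x e (Suc k))) (int (length (padded x e (Suc k)))) 7)"
    using leads_round[of A x k] Suc.prems[of k] by (simp add: padded_Suc add.commute)
  finally show ?case by (rule leads_eq) simp
qed

lemma leads_return:
  assumes "q = 4 \<or> q = 11" "length z > 0"
  shows "h < length z \<Longrightarrow> leads A h (Config (ptape x e z) (int h) q) (Config (ptape x e z) 0 q)"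
proof (induction h)
  case 0
  then show ?case by (simp add: leads_refl)
next
  case (Suc h)
  have "leads A 1 (Config (ptape x e z) (int (Suc h)) q) (Config (ptape x e z) (int h) q)"
    by (rule leads_stay)
      (use assms Suc.prems in \<open>auto simp: ptape_def tape_def heading_def opt_nth_def intro!: rule.return\<close>)
  also have "leads A h (Config (ptape x e z) (int h) q) (Config (ptape x e z) 0 q)"
    using Suc by simp
  finally show ?case by simp
qed

lemma decides_padding_machine:
  assumes no: "\<And>j. j < k \<Longrightarrow> \<not> oracle_mem A (padded x e j)" and yes: "oracle_mem A (padded x e k)"
    and bound: "2 * length x + 2 * e + 5 * k + 18 \<le> n"
  shows "decides machine A n x (oracle_mem A (padded x e k @ [True]))"
proof -
  let ?z = "padded x e k @ [True]" let ?a = "oracle_mem A ?z"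
  let ?q = "if ?a then 11 else 4 :: nat"
  let ?T = "(ptape x e ?z)(0 := Sym (opt_nth x 0) (Some (?z ! 0)) (Some ?a) 1)"
  have "leads A (length x + e + 5) (init_config x) (Config (ptape x e (padded x e 0)) (int (length (padded x e 0))) 7)"
    by (rule leads_padded_0)
  also have "leads A (4 * k) \<dots> (Config (ptape x e (padded x e k)) (int (length (padded x e k))) 7)"
    using no by (rule leads_loop)
  also have "leads A 4 \<dots> (Config (ptape x e ?z) (int (length ?z)) 7)"
    using leads_round[of A x k] yes by (simp add: add.commute)
  also have "leads A 3 (Config (ptape x e ?z) (int (length ?z)) 7) (Config (ptape x e (?z @ [?a])) (int (length ?z)) 10)"
    using leads_ask[of x ?z "padded x e k" True A] by (simp add: length_padded)
  also have "leads A 1 (Config (ptape x e (?z @ [?a])) (int (length ?z)) 10) (Config (ptape x e ?z) (int (length ?z - 1)) ?q)"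
  proof (rule leads_rule)
    have "ptape x e (?z @ [?a]) (int (length ?z)) = Sym None (Some ?a) None 0"
      by (rule ptape_last) (simp add: length_padded)
    then show "rule e (10, ptape x e (?z @ [?a]) (int (length ?z))) (?q, Sym None None None 0)"
      using rule.answer by simp
    show "ptape x e ?z = (ptape x e (?z @ [?a]))(int (length ?z) := Sym None None None 0)"
      by (rule ptape_erase[symmetric]) (simp add: length_padded)
  qed (auto simp: heading_def)
  also have "leads A (length ?z - 1) (Config (ptape x e ?z) (int (length ?z - 1)) ?q) (Config (ptape x e ?z) 0 ?q)"
    by (rule leads_return) auto
  also have "leads A 1 (Config (ptape x e ?z) 0 ?q) (Config ?T (-1) 8)"
  proof (rule leads_rule)
    have "ptape x e ?z 0 = Sym (opt_nth x 0) (Some (?z ! 0)) None 1"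
      by (auto simp: ptape_def tape_def opt_nth_def)
    then show "rule e (?q, ptape x e ?z 0) (8, Sym (opt_nth x 0) (Some (?z ! 0)) (Some ?a) 1)"
      using rule.emit[OF refl] by simp
  qed (auto simp: heading_def)
  also have "leads A 1 (Config ?T (-1) 8) (Config ?T 0 1)"
    by (rule leads_stay) (use rule.halt in \<open>auto simp: heading_def ptape_def tape_def\<close>)
  \<comment> \<open>Each unit of \<open>k\<close> costs four steps in the loop and one on the way
    back; \<open>length x\<close> and \<open>e\<close> are traversed once in each direction.\<close>
  finally have "leads A (2 * length x + 2 * e + 5 * k + 18) (init_config x) (Config ?T 0 q_final)"
    by (rule leads_eq) (simp add: length_padded)
  then show ?thesis
    by (intro decides_machine[OF _ _ _ _ _ bound]) (auto simp: leads_def)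
qed

end

section \<open>An oracle relative to which NP is contained in BQP\<close>

lemma otm_query_cells:
  "(otm_step R A ^^ t) (init_config x) c \<Longrightarrow> finite (query_cells (tape_of c)) \<and> card (query_cells (tape_of c)) \<le> t"
proof (induction t arbitrary: c)
  case 0
  then have "query_cells (tape_of c) = {}"
    by (auto simp: init_config_def query_cells_def init_tape_def blank_def)
  then show ?case by simp
next
  case (Suc t)
  then obtain d where d: "(otm_step R A ^^ t) (init_config x) d" "otm_step R A d c" by auto
  have "\<exists>h. query_cells (tape_of c) \<subseteq> insert h (query_cells (tape_of d))"
    using d(2) by (cases rule: otm_step.cases) (auto simp: query_cells_def elim!: tm_step.cases)
  then obtain h where h: "query_cells (tape_of c) \<subseteq> insert h (query_cells (tape_of d))" by blast
  have fin: "finite (insert h (query_cells (tape_of d)))" using Suc.IH[OF d(1)] by simp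
  have "card (query_cells (tape_of c)) \<le> card (insert h (query_cells (tape_of d)))"
    using h fin by (rule card_mono[rotated])
  also have "\<dots> \<le> Suc (card (query_cells (tape_of d)))" by (rule card_insert_le_m1) auto
  finally show ?case using h fin Suc.IH[OF d(1)] finite_subset by fastforce
qed

lemma length_query_string: "length (query_string T) \<le> card (query_cells T)"
proof (cases "\<exists>a b. a \<le> b \<and> query_cells T = {a..b}")
  case True
  then obtain a b where ab: "a \<le> b" "query_cells T = {a..b}" by blast
  then have "Min {a..b} = a" "Max {a..b} = b" by (auto intro: Min_eqI Max_eqI)
  then show ?thesis using ab by (auto simp: query_string_def)
next
  case False
  then have "query_string T = []" unfolding query_string_def by (rule if_not_P)
  then show ?thesis by simp
qed

text \<open>Each step fills at most one query cell, so the query made in step \<open>t + 1\<close>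
  has length at most \<open>t\<close>, which is below \<open>m\<close> as long as
  \<open>t + 1 \<le> m\<close>.\<close>

lemma otm_agree:
  assumes "\<And>w. length w < m \<Longrightarrow> oracle_mem A w = oracle_mem B w"
  shows "t \<le> m \<Longrightarrow> (otm_step R A ^^ t) (init_config x) c \<longleftrightarrow> (otm_step R B ^^ t) (init_config x) c"
proof (induction t arbitrary: c)
  case 0
  then show ?case by simp
next
  case (Suc t)
  have "otm_step R A d c \<longleftrightarrow> otm_step R B d c" if "(otm_step R A ^^ t) (init_config x) d" for d
  proof -
    have "length (query_string (tape_of d)) < m"
      using otm_query_cells[OF that] length_query_string[of "tape_of d"] Suc.prems by simp
    then have "oracle_mem A (query_string (tape_of d)) = oracle_mem B (query_string (tape_of d))"
      by (rule assms)
    then show ?thesis by (cases d) (auto simp: otm_step.simps)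
  qed
  with Suc show ?case by (auto simp: OO_def)
qed

section \<open>Unique decoding of the padded strings\<close>

lemma replicate_append_eqD:
  assumes "replicate m a @ b # u = replicate n a @ b # v" "a \<noteq> b"
  shows "m = n \<and> u = v"
  using assms(1)
proof (induction m arbitrary: n)
  case 0
  then show ?case using assms(2) by (cases n) auto
next
  case (Suc m)
  then show ?case using assms(2) by (cases n) auto
qed

lemma padded_inj:
  assumes "padded x e k = padded x' e' k'"
  shows "x = x' \<and> e = e' \<and> k = k'"
proof -
  have rev: "rev (padded y d j) = replicate (Suc j) False @ True # replicate d False @ True # rev y" for y d j
    by (simp add: padded_def replicate_append_same)
  have "rev (padded x e k) = rev (padded x' e' k')" using assms by simp
  then have 1: "Suc k = Suc k' \<and> replicate e False @ True # rev x = replicate e' False @ True # rev x'"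
    unfolding rev by (rule replicate_append_eqD) simp
  then have "e = e' \<and> rev x = rev x'"
    by (intro replicate_append_eqD[of e False True "rev x" e' "rev x'"]) auto
  with 1 show ?thesis by simp
qed

lemma padded_eq_iff: "padded x e k = padded x' e' k' \<longleftrightarrow> x = x' \<and> e = e' \<and> k = k'"
  using padded_inj by blast

text \<open>Stop signals and questions are told apart by their last bit; this relies on
  \<open>padded\<close> ending in at least one False, hence the \<open>Suc k\<close> there.\<close>

lemma padded_not_snoc_True: "padded x e k \<noteq> padded x' e' k' @ [True]"
proof
  assume "padded x e k = padded x' e' k' @ [True]"
  then have "last (padded x e k) = True" by simp
  then show False by (simp add: padded_def split: if_splits)
qed

text \<open>Unboundedly many codes for each pair allow one to be chosen that is at least the length
  of a prescribed finite part of the oracle.\<close>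

definition coding :: "(nat \<Rightarrow> rules \<times> nat poly) \<Rightarrow> bool" where
  "coding dec \<longleftrightarrow> (\<forall>R p N. finite R \<longrightarrow> (\<exists>e\<ge>N. dec e = (R, p)))"

lemma ex_coding: "\<exists>dec. coding dec"
proof -
  let ?S = "{R :: rules. finite R} \<times> (UNIV :: nat poly set)"
  have "countable ?S" by (intro countable_SIGMA countable_finite_rules) auto
  moreover have "?S \<noteq> {}" by blast
  ultimately have range: "range (from_nat_into ?S) = ?S" by (rule range_from_nat_into[rotated])
  define dec where "dec e = from_nat_into ?S (fst (prod_decode e))" for e
  have "\<exists>e\<ge>N. dec e = (R, p)" if "finite R" for R p N
  proof -
    have "(R, p) \<in> range (from_nat_into ?S)" unfolding range using that by simp
    then obtain i where i: "from_nat_into ?S i = (R, p)" by (metis imageE)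
    have "N \<le> prod_encode (i, N)" by (rule le_prod_encode_2)
    then show ?thesis using i by (intro exI[of _ "prod_encode (i, N)"]) (simp add: dec_def)
  qed
  then show ?thesis unfolding coding_def by blast
qed

context
  fixes dec :: "nat \<Rightarrow> rules \<times> nat poly" and N :: nat and A0 :: cantor
begin

text \<open>The first kind of string is the stop signal, telling that \<open>k\<close> has reached
  the time bound; the second asks whether the machine with code \<open>e\<close> accepts
  \<open>x\<close> within \<open>k\<close> steps. The argument \<open>A\<close> stands for the
  oracle already built on shorter strings.\<close>

definition oracle_bit :: "cantor \<Rightarrow> bool list \<Rightarrow> bool" where
  "oracle_bit A w = (if str_num w < N then A0 (str_num w) else
     (\<exists>x e k. w = padded x e k \<and> poly (snd (dec e)) (length x) \<le> k) \<or>
     (\<exists>x e k. w = padded x e k @ [True] \<and>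
        (\<exists>t\<le>k. \<exists>c. (otm_step (fst (dec e)) A ^^ t) (init_config x) c \<and> state_of c = q_final)))"

text \<open>The answer on strings of length \<open>m\<close> refers to the oracle only below length \<open>m\<close>.\<close>

primrec oracle_below :: "nat \<Rightarrow> cantor" where
  "oracle_below 0 = (\<lambda>_. False)"
| "oracle_below (Suc m) = (\<lambda>i. if length (inv str_num i) = m then oracle_bit (oracle_below m) (inv str_num i)
     else oracle_below m i)"

definition full_oracle :: cantor where
  "full_oracle i = oracle_bit (oracle_below (length (inv str_num i))) (inv str_num i)"

lemma inv_str_num: "inv str_num (str_num w) = w"
  using bij_str_num by (simp add: bij_is_inj)

lemma oracle_below_eq: "oracle_mem (oracle_below m) w \<longleftrightarrow> length w < m \<and> oracle_mem full_oracle w"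
  by (induction m) (auto simp: inv_str_num full_oracle_def)

lemma full_oracle_cylinder: "full_oracle \<in> cylinder N A0"
proof -
  have "str_num (inv str_num i) = i" for i
    using bij_str_num by (simp add: bij_is_surj surj_f_inv_f)
  then show ?thesis by (simp add: cylinder_def full_oracle_def oracle_bit_def)
qed

lemma oracle_bit_padded:
  assumes "N \<le> e"
  shows "oracle_bit A (padded x e k) \<longleftrightarrow> poly (snd (dec e)) (length x) \<le> k"
proof -
  have "\<not> str_num (padded x e k) < N"
    using length_le_str_num[of "padded x e k"] assms by (simp add: length_padded)
  then show ?thesis
    by (auto simp: oracle_bit_def padded_not_snoc_True padded_eq_iff)
qed

lemma oracle_bit_answer:
  assumes "N \<le> e"
  shows "oracle_bit A (padded x e k @ [True]) \<longleftrightarrow>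
     (\<exists>t\<le>k. \<exists>c. (otm_step (fst (dec e)) A ^^ t) (init_config x) c \<and> state_of c = q_final)"
proof -
  have "\<not> str_num (padded x e k @ [True]) < N"
    using length_le_str_num[of "padded x e k @ [True]"] assms by (simp add: length_padded)
  then show ?thesis
    by (auto simp: oracle_bit_def padded_not_snoc_True[symmetric] padded_eq_iff)
qed

lemma full_oracle_eq: "oracle_mem full_oracle w = oracle_bit (oracle_below (length w)) w"
  by (simp add: full_oracle_def inv_str_num)

text \<open>The fixed-point property: the question is longer than \<open>k\<close>, so a run of at
  most \<open>k\<close> steps cannot distinguish the part of the oracle below that length from the
  full oracle.\<close>

lemma full_oracle_answer:
  assumes "N \<le> e"
  shows "oracle_mem full_oracle (padded x e k @ [True]) \<longleftrightarrow>
     (\<exists>t\<le>k. \<exists>c. (otm_step (fst (dec e)) full_oracle ^^ t) (init_config x) c \<and> state_of c = q_final)"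
proof -
  let ?w = "padded x e k @ [True]"
  have "(otm_step (fst (dec e)) (oracle_below (length ?w)) ^^ t) (init_config x) c \<longleftrightarrow>
      (otm_step (fst (dec e)) full_oracle ^^ t) (init_config x) c" if "t \<le> k" for t c
    by (rule otm_agree[where m = "length ?w"])
      (use that in \<open>simp_all add: oracle_below_eq length_padded del: oracle_below.simps\<close>)
  then show ?thesis unfolding full_oracle_eq oracle_bit_answer[OF assms] by blast
qed

lemma NP_subset_BQP_full_oracle:
  assumes "coding dec"
  shows "NP full_oracle \<subseteq> BQP full_oracle"
proof
  fix L assume "L \<in> NP full_oracle"
  then obtain R p where R: "finite R"
    and stops: "\<And>x. \<nexists>c. (otm_step R full_oracle ^^ Suc (poly p (length x))) (init_config x) c"
    and L: "\<And>x. x \<in> L \<longleftrightarrow> (\<exists>c. (otm_step R full_oracle)\<^sup>*\<^sup>* (init_config x) c \<and> state_of c = q_final)"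
    unfolding NP_def by blast
  obtain e where e: "N \<le> e" "dec e = (R, p)"
    using assms R unfolding coding_def by blast
  obtain g where g: "padding_machine e g"
    using ex_transition[of e] by (auto simp: padding_machine_def)
  interpret padding_machine e g by (rule g)
  \<comment> \<open>Every path stops within the time bound, so acceptance at all is acceptance
    within \<open>k = poly p (length x)\<close> steps, and this is the first \<open>k\<close> at
    which the stop signal appears.\<close>
  have L': "x \<in> L \<longleftrightarrow> oracle_mem full_oracle (padded x e (poly p (length x)) @ [True])" for x
  proof -
    have "t \<le> poly p (length x)" if t: "(otm_step R full_oracle ^^ t) (init_config x) c" for t c
    proof (rule ccontr)
      assume "\<not> t \<le> poly p (length x)"
      then have "t = Suc (poly p (length x)) + (t - Suc (poly p (length x)))" by simp
      then have "((otm_step R full_oracle ^^ Suc (poly p (length x))) OO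
          (otm_step R full_oracle ^^ (t - Suc (poly p (length x))))) (init_config x) c"
        using t by (metis relpowp_add)
      then show False using stops[of x] by blast
    qed
    then show ?thesis
      unfolding L full_oracle_answer[OF e(1)] e(2) rtranclp_power by auto
  qed
  \<comment> \<open>The exact running time with \<open>k = poly p (length x)\<close>; the code
    \<open>e\<close> is a constant of the machine.\<close>
  let ?q = "[:18 + 2 * e, 2:] + smult 5 p"
  have "decides machine full_oracle (poly ?q (length x)) x (x \<in> L)" for x
    unfolding L'
  proof (rule decides_padding_machine)
    show "oracle_mem full_oracle (padded x e (poly p (length x)))"
      by (simp add: full_oracle_eq oracle_bit_padded e)
    show "\<not> oracle_mem full_oracle (padded x e j)" if "j < poly p (length x)" for j
      using that by (simp add: full_oracle_eq oracle_bit_padded e)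
  qed (simp add: algebra_simps)
  then show "L \<in> BQP full_oracle"
    unfolding BQP_iff using is_qtm_machine well_formed_machine normal_form_machine by blast
qed

end

lemma dense_NP_subset_BQP: "cyl_dense {A. NP A \<subseteq> BQP A}"
  unfolding cyl_dense_def using ex_coding full_oracle_cylinder NP_subset_BQP_full_oracle by blast

theorem theorem2p9:
  shows "\<not> fsigma {A :: nat \<Rightarrow> bool. \<not> NP A \<subseteq> BQP A}"
  by (rule not_fsigma_if_dense[OF dense_NP_subset_BQP])

end
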